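(* Let $f\in C^2(\mathbb{S}^1)$ be a non-constant function and $H(I,\varphi)=I^2/2+f(\varphi)$ on $\mathbb{R}\times\mathbb{S}^1$. For $c>\max f$ and $\delta\in\mathbb{R}$ put $$a_\delta(c):=\int_0^{2\pi}\frac{d\varphi}{[2(c-f(\varphi))]^{\delta}} .$$ With $c(\cdot)$, $E_1(k)$ and $E_2(k)$ as defined in the context: (i) For any $r>0$ and $R>0$ satisfying $c(R)>\max f+r$, there exist $K>0$ and $c_R>0$ such that $$E_1(k)\ge\frac{c_R}{k^2}\qquad\text{for all }k>K,$$ and in particular this holds with $$c_R:=4\pi\int_{\max f+r}^{c(R)}\frac{-a_{3/2}(c)^2+a_{5/2}(c)\,a_{1/2}(c)}{a_{1/2}(c)^3}\,dc .$$ (ii) For any $\tilde I>0$ such that $c(\tilde I)>\max f$, there exists $c_{\tilde I}>0$ such that $$\lim_{k\to+\infty}k^2E_2(k)=c_{\tilde I},$$ namely $$c_{\tilde I}:=\frac{1}{a_{1/2}(c(\tilde I))}\int_0^{2\pi}\frac{|f'(\varphi)|^2}{[2(c(\tilde I)-f(\varphi))]^{5/2}}\,d\varphi .$$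
   Context: $\mathbb{S}^1=\mathbb{R}/2\pi\mathbb{Z}$; $k\ge 1$ is an integer. $W:[0,+\infty)\to[0,+\infty)$ is the (real, increasing) Lambert function, $z=W(z)e^{W(z)}$. For $c\in\mathbb{R}$, $\varphi\in\mathbb{S}^1$: $\gamma_k(c,\varphi):=\sqrt{\frac{W(e^{2(c-f(\varphi))k}k)}{k}}$; $\gamma_0(c,\varphi):=\sqrt{2(c-f(\varphi))}$ if $c>f(\varphi)$ and $0$ otherwise. For $\tilde I>0$, $c_k(\tilde I)$ is the unique real $c$ with $\tilde I=\frac1{2\pi}\int_0^{2\pi}\gamma_k(c,\varphi)d\varphi$, and $c(\tilde I)$ is the unique real $c$ with $\tilde I=\frac1{2\pi}\int_0^{2\pi}\gamma_0(c,\varphi)d\varphi$. For $\tilde I>0$ (and $\varphi$ represented in $[0,2\pi]$): $$u_k(\tilde I,\varphi):=\tilde I(\pi-\varphi)-\frac1{2\pi}\int_0^{2\pi}\!\!\int_0^y\gamma_k(c_k(\tilde I),x)\,dx\,dy+\int_0^\varphi\gamma_k(c_k(\tilde I),x)\,dx,$$ $$\sigma_k(\tilde I,\varphi):=\frac{1/\gamma_k(c_k(\tilde I),\varphi)}{\int_0^{2\pi}\frac{dx}{\gamma_k(c_k(\tilde I),x)}},\qquad \bar H_k(\tilde I):=c_k(\tilde I)+\frac1k\log\int_0^{2\pi}\frac{d\varphi}{\gamma_k(c_k(\tilde I),\varphi)}.$$ For $\tilde I<0$: $u_k(\tilde I,\varphi):=-u_k(|\tilde I|,\varphi)$, $\sigma_k(\tilde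 I,\varphi):=\sigma_k(|\tilde I|,\varphi)$, $\bar H_k(\tilde I):=\bar H_k(|\tilde I|)$ (the value $\tilde I=0$ is irrelevant below). For fixed $\tilde I$, $\mathcal{C}^t_{\tilde I}(\varphi)$ is the flow on $\mathbb{S}^1$ of $\dot\varphi=\tilde I+\frac{\partial u_k}{\partial\varphi}(\tilde I,\varphi)$. Put $\varphi^t:=\mathcal{C}^t_{\tilde I}(\varphi)$, $I^t:=\tilde I+\frac{\partial u_k}{\partial\varphi}(\tilde I,\varphi^t)$, $\tilde\varphi^t:=\varphi^t+\frac{\partial u_k}{\partial\tilde I}(\tilde I,\varphi^t)$. Then $$E_1(k):=\int_{|\tilde I|\le R}\int_0^{2\pi}\Big|\frac{\partial\tilde\varphi^t}{\partial t}-\bar H_k'(\tilde I)\Big|^2\sigma_k(\tilde I,\varphi)\,d\varphi\,d\tilde I,\qquad E_2(k):=\int_0^{2\pi}\Big|\frac{\partial I^t}{\partial t}+f'(\varphi^t)\Big|^2\sigma_k(\tilde I,\varphi)\,d\varphi .$$ These do not depend on $t\in\mathbb{R}$ because $\mathcal{C}^t_{\tilde I}$ preserves the measure $\sigma_k(\tilde I,\varphi)d\varphi$; $E_1(k)$ depends on $R$ and $E_2(k)$ depends on $\tilde I$. *)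

theory Defs
  imports "HOL-Analysis.Analysis" "HOL-Library.Real_Mod"
begin

text \<open>
  Functions on the circle of length \<open>2 * pi\<close> are \<open>2 * pi\<close>-periodic functions on the reals, and the
  circle is integrated over \<open>{0..2*pi}\<close>. The variable \<open>J\<close> is the
  transformed action (usually written as an \<open>I\<close> with a tilde).
\<close>

definition C2_circle :: "(real \<Rightarrow> real) \<Rightarrow> bool" where
  "C2_circle f \<longleftrightarrow>
     (\<forall>x. f (x + 2 * pi) = f x) \<and>
     (\<forall>x. f differentiable at x) \<and>
     (\<forall>x. deriv f differentiable at x) \<and>
     continuous_on UNIV (deriv (deriv f))"

text \<open>The maximum of \<open>f\<close>: for continuous periodic \<open>f\<close> this supremum is attained.\<close>

definition max_circle :: "(real \<Rightarrow> real) \<Rightarrow> real" where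
  "max_circle f = (SUP x. f x)"

definition lambert_W :: "real \<Rightarrow> real" where
  "lambert_W z = (THE w. w \<ge> 0 \<and> z = w * exp w)"

definition gam :: "(real \<Rightarrow> real) \<Rightarrow> nat \<Rightarrow> real \<Rightarrow> real \<Rightarrow> real" where
  "gam f k c \<phi> = sqrt (lambert_W (exp (2 * (c - f \<phi>) * real k) * real k) / real k)"

text \<open>The limiting profile \<open>gam0\<close> is a separate constant, not the case \<open>k = 0\<close> of \<open>gam\<close>.\<close>

definition gam0 :: "(real \<Rightarrow> real) \<Rightarrow> real \<Rightarrow> real \<Rightarrow> real" where
  "gam0 f c \<phi> = (if c > f \<phi> then sqrt (2 * (c - f \<phi>)) else 0)"

text \<open>The next two are meaningful for \<open>J > 0\<close> only (and \<open>k \<ge> 1\<close> in the first).\<close>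

definition ck :: "(real \<Rightarrow> real) \<Rightarrow> nat \<Rightarrow> real \<Rightarrow> real" where
  "ck f k J = (THE c. J = 1 / (2 * pi) * integral {0..2*pi} (\<lambda>\<phi>. gam f k c \<phi>))"

definition c0 :: "(real \<Rightarrow> real) \<Rightarrow> real \<Rightarrow> real" where
  "c0 f J = (THE c. J = 1 / (2 * pi) * integral {0..2*pi} (\<lambda>\<phi>. gam0 f c \<phi>))"

text \<open>
  The generating function for positive action, evaluated at the representative of \<open>\<phi>\<close> in
  \<open>{0..<2*pi}\<close>, which makes it a function on the circle.
\<close>

definition u_pos :: "(real \<Rightarrow> real) \<Rightarrow> nat \<Rightarrow> real \<Rightarrow> real \<Rightarrow> real" where
  "u_pos f k J \<phi> =
     J * (pi - \<phi> rmod (2 * pi))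
     - 1 / (2 * pi) * integral {0..2*pi} (\<lambda>y. integral {0..y} (\<lambda>x. gam f k (ck f k J) x))
     + integral {0..\<phi> rmod (2 * pi)} (\<lambda>x. gam f k (ck f k J) x)"

text \<open>
  Extension to negative actions. At \<open>J = 0\<close> the values are arbitrary; they only enter
  \<open>E1\<close>, on a null set.
\<close>

definition u_gen :: "(real \<Rightarrow> real) \<Rightarrow> nat \<Rightarrow> real \<Rightarrow> real \<Rightarrow> real" where
  "u_gen f k J \<phi> = (if J < 0 then - u_pos f k \<bar>J\<bar> \<phi> else u_pos f k J \<phi>)"

definition sigma :: "(real \<Rightarrow> real) \<Rightarrow> nat \<Rightarrow> real \<Rightarrow> real \<Rightarrow> real" where
  "sigma f k J \<phi> =
     (1 / gam f k (ck f k \<bar>J\<bar>) \<phi>) / integral {0..2*pi} (\<lambda>x. 1 / gam f k (ck f k \<bar>J\<bar>) x)"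

definition Hbar :: "(real \<Rightarrow> real) \<Rightarrow> nat \<Rightarrow> real \<Rightarrow> real" where
  "Hbar f k J =
     ck f k \<bar>J\<bar> + 1 / real k * ln (integral {0..2*pi} (\<lambda>\<phi>. 1 / gam f k (ck f k \<bar>J\<bar>) \<phi>))"

definition u_\<phi> :: "(real \<Rightarrow> real) \<Rightarrow> nat \<Rightarrow> real \<Rightarrow> real \<Rightarrow> real" where
  "u_\<phi> f k J \<phi> = deriv (\<lambda>\<psi>. u_gen f k J \<psi>) \<phi>"

definition u_J :: "(real \<Rightarrow> real) \<Rightarrow> nat \<Rightarrow> real \<Rightarrow> real \<Rightarrow> real" where
  "u_J f k J \<phi> = deriv (\<lambda>I. u_gen f k I \<phi>) J"

text \<open>
  The flow is lifted to the reals: \<open>flow f k J t \<phi>\<close> is the value at time \<open>t\<close> of the solution,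
  defined for all times, that starts in \<open>\<phi>\<close>.
\<close>

definition flow :: "(real \<Rightarrow> real) \<Rightarrow> nat \<Rightarrow> real \<Rightarrow> real \<Rightarrow> real \<Rightarrow> real" where
  "flow f k J t \<phi> =
     (THE y. y 0 = \<phi> \<and>
        (\<forall>s. (y has_real_derivative J + u_\<phi> f k J (y s)) (at s))) t"

definition action_t :: "(real \<Rightarrow> real) \<Rightarrow> nat \<Rightarrow> real \<Rightarrow> real \<Rightarrow> real \<Rightarrow> real" where
  "action_t f k J \<phi> t = J + u_\<phi> f k J (flow f k J t \<phi>)"

definition angle_t :: "(real \<Rightarrow> real) \<Rightarrow> nat \<Rightarrow> real \<Rightarrow> real \<Rightarrow> real \<Rightarrow> real" where
  "angle_t f k J \<phi> t = flow f k J t \<phi> + u_J f k J (flow f k J t \<phi>)"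

text \<open>
  \<open>E1\<close> and \<open>E2\<close> carry the time \<open>t\<close> at which the defining expression is evaluated; that
  the value is independent of \<open>t\<close> is not built into the definition.
\<close>

definition E1 :: "(real \<Rightarrow> real) \<Rightarrow> real \<Rightarrow> nat \<Rightarrow> real \<Rightarrow> real" where
  "E1 f R k t =
     integral {-R..R} (\<lambda>J. integral {0..2*pi} (\<lambda>\<phi>.
       \<bar>deriv (angle_t f k J \<phi>) t - deriv (Hbar f k) J\<bar>\<^sup>2 * sigma f k J \<phi>))"

definition E2 :: "(real \<Rightarrow> real) \<Rightarrow> real \<Rightarrow> nat \<Rightarrow> real \<Rightarrow> real" where
  "E2 f J k t =
     integral {0..2*pi} (\<lambda>\<phi>.
       \<bar>deriv (action_t f k J \<phi>) t + deriv f (flow f k J t \<phi>)\<bar>\<^sup>2 * sigma f k J \<phi>)"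

definition a_int :: "(real \<Rightarrow> real) \<Rightarrow> real \<Rightarrow> real \<Rightarrow> real" where
  "a_int f \<delta> c = integral {0..2*pi} (\<lambda>\<phi>. 1 / (2 * (c - f \<phi>)) powr \<delta>)"

end

theory Submission
  imports Defs
begin

text \<open>
  The profile \<open>\<gamma> = gam f k c \<phi>\<close> solves \<open>\<gamma>\<^sup>2 / 2 + ln \<gamma> / k = c - f \<phi>\<close>. For \<open>J > 0\<close> and
  \<open>c = ck f k J\<close> one has \<open>J + u_\<phi> = \<gamma>\<close>, so the flow is \<open>\<phi>' = \<gamma>\<close>; it is conjugated to a
  translation and preserves \<open>d\<phi> / \<gamma>\<close>, which removes the time from both errors. With
  \<open>w = 1 / (k * \<gamma>\<^sup>2 + 1)\<close> one has \<open>\<partial>\<gamma> / \<partial>c = (1 - w) / \<gamma>\<close>, and the time derivative of the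
  angle is \<open>(1 - w) * dc / dJ\<close>, whose mean is the derivative of \<open>Hbar\<close>. So \<open>E2\<close> is the mean of
  \<open>(f' * w)\<^sup>2\<close> and \<open>E1\<close> is the integral over \<open>J\<close> of the variance of \<open>w\<close> times
  \<open>(dc / dJ)\<^sup>2\<close>; substituting \<open>c\<close> for \<open>J\<close> leaves the variance times \<open>dc / dJ\<close>. For
  \<open>c > max f\<close>, \<open>k * w\<close> tends to \<open>1 / (2 * (c - f))\<close>, which gives the constants by dominated
  convergence. The lower bound holds with the limit constant itself because the levels between
  \<open>max f + r / 2\<close> and \<open>max f + r\<close> contribute a fixed positive amount.
\<close>

section \<open>Periodic functions and flows on the circle\<close>

lemma antiderivative_on_reals:
  fixes p :: "real \<Rightarrow> real"
  assumes "continuous_on UNIV p"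
  obtains P where "P 0 = 0" "\<And>x. (P has_real_derivative p x) (at x)"
proof -
  have "\<exists>F. \<forall>x::real. -\<infinity> < x \<longrightarrow> x < \<infinity> \<longrightarrow> (F has_vector_derivative p x) (at x)"
    by (rule einterval_antiderivative) (use assms continuous_on_eq_continuous_at in auto)
  then obtain F where F: "\<And>x. (F has_real_derivative p x) (at x)"
    by (auto simp: has_real_derivative_iff_has_vector_derivative)
  show thesis
    by (rule that[of "\<lambda>x. F x - F 0"]) (auto intro!: derivative_eq_intros F)
qed

lemma integral_antiderivative:
  fixes p :: "real \<Rightarrow> real"
  assumes "\<And>x. (P has_real_derivative p x) (at x)" "a \<le> b"
  shows "(p has_integral P b - P a) {a..b}"
  using assms(2)
  by (intro fundamental_theorem_of_calculus)
     (auto intro!: has_vector_derivative_at_within[OF assms(1)[unfolded has_real_derivative_iff_has_vector_derivative]])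

text \<open>The increment of \<open>P\<close> over one period has derivative zero, hence does not
  depend on the starting point. A zero mean makes \<open>P\<close> periodic; a general mean lets any
  interval of length \<open>2 * pi\<close> replace \<open>{0..2 * pi}\<close>.\<close>

lemma antiderivative_shift:
  fixes p :: "real \<Rightarrow> real"
  assumes P: "\<And>x. (P has_real_derivative p x) (at x)"
    and per: "\<And>x. p (x + 2 * pi) = p x"
  shows "P (x + 2 * pi) = P x + integral {0..2 * pi} p"
proof -
  have "((\<lambda>x. P (x + 2 * pi) - P x) has_real_derivative 0) (at x)" for x
    by (rule derivative_eq_intros DERIV_chain2[OF P, of "\<lambda>x. x + 2 * pi" 1] P | simp add: per)+
  then have "P (x + 2 * pi) - P x = P (0 + 2 * pi) - P 0"
    using DERIV_isconst_all[of "\<lambda>x. P (x + 2 * pi) - P x" x 0] by simp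
  then show ?thesis
    using integral_unique[OF integral_antiderivative[OF P, of 0 "2 * pi"]] by simp
qed

lemma periodic_of_int:
  fixes P :: "real \<Rightarrow> 'a"
  assumes per: "\<And>x. P (x + 2 * pi) = P x"
  shows "P (x + of_int n * (2 * pi)) = P x"
proof (induction n rule: int_induct[where k = 0])
  case (step1 i)
  then show ?case
    using per[of "x + of_int i * (2 * pi)"] by (simp add: algebra_simps)
next
  case (step2 i)
  then show ?case
    using per[of "x + of_int (i - 1) * (2 * pi)"] by (simp add: algebra_simps)
qed simp

lemma periodic_rmod:
  fixes P :: "real \<Rightarrow> 'a"
  assumes per: "\<And>x. P (x + 2 * pi) = P x"
  shows "P (x rmod (2 * pi)) = P x"
  using periodic_of_int[of P x "- \<lfloor>x / (2 * pi)\<rfloor>", OF per] by (simp add: rmod_def mult.commute)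

lemma rmod_circle_bounds: "0 \<le> x rmod (2 * pi)" "x rmod (2 * pi) \<le> 2 * pi"
  using rmod_nonneg[of "2 * pi" x] rmod_le[of "2 * pi" x] by simp_all

text \<open>The reduction \<open>x rmod (2 * pi)\<close> jumps at the multiples of
  \<open>2 * pi\<close>. A zero mean makes the primitive periodic, so the jump is invisible and the
  derivative exists there too.\<close>

lemma integral_rmod_has_derivative:
  fixes p :: "real \<Rightarrow> real"
  assumes cont: "continuous_on UNIV p" and per: "\<And>x. p (x + 2 * pi) = p x"
    and zero: "integral {0..2 * pi} p = 0"
  shows "((\<lambda>x. integral {0..x rmod (2 * pi)} p) has_real_derivative p x) (at x)"
proof -
  obtain P where P: "P 0 = 0" "\<And>x. (P has_real_derivative p x) (at x)"
    using antiderivative_on_reals[OF cont] by blast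
  have "P (x rmod (2 * pi)) = P x" for x
    by (rule periodic_rmod) (use antiderivative_shift[OF P(2) per] zero in simp)
  then have "integral {0..x rmod (2 * pi)} p = P x" for x
    using integral_unique[OF integral_antiderivative[OF P(2) rmod_circle_bounds(1)]] P(1) by simp
  then show ?thesis using P(2) by simp
qed

lemma surj_of_derivative_ge:
  fixes T :: "real \<Rightarrow> real"
  assumes T: "\<And>x. (T has_real_derivative T' x) (at x)" and m: "m > 0" "\<And>x. T' x \<ge> m"
  shows "\<exists>x. T x = y"
proof -
  have grow: "T b - T a \<ge> m * (b - a)" if "a \<le> b" for a b
  proof -
    have "T a - m * a \<le> T b - m * b"
      using that
      by (intro DERIV_nonneg_imp_nondecreasing[of a b "\<lambda>x. T x - m * x"])
         (auto intro!: exI derivative_eq_intros T m)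
    then show ?thesis by (simp add: algebra_simps)
  qed
  \<comment> \<open>At slope at least \<open>m\<close>, the distance \<open>d\<close> is long enough
    for \<open>T\<close> to move from \<open>T 0\<close> past \<open>y\<close>, on whichever side
    \<open>y\<close> lies.\<close>
  define d where "d = \<bar>y - T 0\<bar> / m"
  have d: "d \<ge> 0" "m * d = \<bar>y - T 0\<bar>" using m by (auto simp: d_def)
  have "T (- d) \<le> y" "y \<le> T d"
    using grow[of "-d" 0] grow[of 0 d] d by auto
  moreover have "\<forall>x. - d \<le> x \<and> x \<le> d \<longrightarrow> isCont T x"
    using T DERIV_isCont by blast
  ultimately show ?thesis using IVT[of T "-d" y d] d(1) by auto
qed

lemma periodic_attains_inf:
  fixes p :: "real \<Rightarrow> real"
  assumes cont: "continuous_on UNIV p" and per: "\<And>x. p (x + 2 * pi) = p x"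
  shows "\<exists>x\<^sub>0. \<forall>x. p x\<^sub>0 \<le> p x"
proof -
  have "continuous_on {0..2 * pi} p" using cont continuous_on_subset by blast
  then obtain x\<^sub>0 where "\<And>y. y \<in> {0..2 * pi} \<Longrightarrow> p x\<^sub>0 \<le> p y"
    using continuous_attains_inf[of "{0..2 * pi}" p] pi_ge_zero by (metis atLeastAtMost_iff compact_Icc empty_iff mult_nonneg_nonneg order_refl zero_le_numeral)
  then have "p x\<^sub>0 \<le> p (x rmod (2 * pi))" for x
    using rmod_circle_bounds by simp
  then show ?thesis using periodic_rmod[of p, OF per] by auto
qed

lemma periodic_attains_sup:
  fixes p :: "real \<Rightarrow> real"
  assumes cont: "continuous_on UNIV p" and per: "\<And>x. p (x + 2 * pi) = p x"
  shows "\<exists>x\<^sub>1. \<forall>x. p x \<le> p x\<^sub>1"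
  using periodic_attains_inf[of "\<lambda>x. - p x"] assms by (auto intro: continuous_intros)

text \<open>The common tool for three inverses: that of the time map of a flow, the profile
  \<open>prof k\<close>, and the level \<open>ck f k\<close> as inverse of the action.\<close>

lemma inverse_has_real_derivative:
  fixes F G :: "real \<Rightarrow> real"
  assumes "open S" "x \<in> S" and F: "\<And>z. z \<in> S \<Longrightarrow> (F has_real_derivative F' z) (at z)"
    and "F' x \<noteq> 0" and GF: "\<And>z. z \<in> S \<Longrightarrow> G (F z) = z"
  shows "(G has_real_derivative 1 / F' x) (at (F x))"
  unfolding has_field_derivative_def
proof (rule has_derivative_inverse_strong[of S x F G])
  show "continuous_on S F"
    using F by (meson DERIV_continuous_on has_field_derivative_at_within)
  show "(F has_derivative (*) (F' x)) (at x)"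
    using F[OF assms(2)] by (simp add: has_field_derivative_def)
qed (use assms in auto)

text \<open>The flow is conjugated to a translation by the time map \<open>T\<close>, a primitive of \<open>1 / v\<close>.\<close>

lemma periodic_flow:
  fixes v :: "real \<Rightarrow> real" and s :: real
  assumes cont: "continuous_on UNIV v" and pos: "\<And>x. v x > 0"
    and per: "\<And>x. v (x + 2 * pi) = v x"
  obtains Y where "\<And>\<phi>. Y 0 \<phi> = \<phi>"
    "\<And>t \<phi>. ((\<lambda>t. Y t \<phi>) has_real_derivative s * v (Y t \<phi>)) (at t)"
    "\<And>\<phi> y. y 0 = \<phi> \<Longrightarrow> (\<And>t. (y has_real_derivative s * v (y t)) (at t)) \<Longrightarrow> y = (\<lambda>t. Y t \<phi>)"
    "\<And>F t. continuous_on UNIV F \<Longrightarrow> (\<And>x. F (x + 2 * pi) = F x) \<Longrightarrow>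
       integral {0..2 * pi} (\<lambda>\<phi>. F (Y t \<phi>) * (1 / v \<phi>)) = integral {0..2 * pi} (\<lambda>\<phi>. F \<phi> * (1 / v \<phi>))"
proof -
  have cont': "continuous_on UNIV (\<lambda>x. 1 / v x)"
    using pos by (intro continuous_intros cont) (metis less_irrefl)
  have per': "1 / v (x + 2 * pi) = 1 / v x" for x using per by simp
  obtain T where T: "\<And>x. (T has_real_derivative 1 / v x) (at x)"
    using antiderivative_on_reals[OF cont'] by blast
  \<comment> \<open>At a maximum of \<open>v\<close> the slope \<open>1 / v\<close> of the time map
    is smallest. This positive lower bound makes \<open>T\<close> onto, so that solutions exist for
    all times.\<close>
  obtain x\<^sub>1 where x1: "\<And>x. v x \<le> v x\<^sub>1"
    using periodic_attains_sup[of v, OF cont per] by blast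
  have surjT: "\<exists>x. T x = y" for y
    by (rule surj_of_derivative_ge[OF T, of "1 / v x\<^sub>1"])
       (simp_all add: pos x1 divide_left_mono)
  have "strict_mono T"
  proof (rule strict_monoI)
    fix x y :: real
    assume "x < y"
    then show "T x < T y"
    proof (rule DERIV_pos_imp_increasing)
      show "\<exists>d. (T has_real_derivative d) (at z) \<and> 0 < d" for z
        using T[of z] pos[of z] by (intro exI[of _ "1 / v z"]) simp
    qed
  qed
  then have injT: "T x = T y \<longleftrightarrow> x = y" for x y by (simp add: strict_mono_eq)
  define S where "S = inv T"
  have TS: "T (S y) = y" for y unfolding S_def using surjT by (metis f_inv_into_f rangeI)
  have ST: "S (T x) = x" for x using TS injT by blast
  have dS: "(S has_real_derivative v (S y)) (at y)" for y
    using inverse_has_real_derivative[of UNIV "S y" T "\<lambda>x. 1 / v x" S] pos[of "S y"]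
    by (simp add: TS ST T)
  define Y where "Y = (\<lambda>t \<phi>. S (T \<phi> + s * t))"
  have Y1: "((\<lambda>t. Y t \<phi>) has_real_derivative s * v (Y t \<phi>)) (at t)" for t \<phi>
    unfolding Y_def
    by (rule DERIV_cong[OF DERIV_chain2[OF dS, of "\<lambda>t. T \<phi> + s * t" s]])
       (auto intro!: derivative_eq_intros)
  have Y2: "((\<lambda>\<phi>. Y t \<phi>) has_real_derivative v (Y t \<phi>) * (1 / v \<phi>)) (at \<phi>)" for t \<phi>
    unfolding Y_def
    by (rule derivative_eq_intros DERIV_chain2[OF dS, of "\<lambda>\<phi>. T \<phi> + s * t" "1 / v \<phi>"] T | simp)+
  \<comment> \<open>The time map gains the same amount over every full turn, so the solution started
    at \<open>2 * pi\<close> stays exactly one turn ahead of the one started at 0.\<close>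
  have Y3: "Y t (2 * pi) = Y t 0 + 2 * pi" for t
  proof -
    have "T (Y t 0 + 2 * pi) = T (Y t (2 * pi))"
      using antiderivative_shift[OF T per', of "Y t 0"] antiderivative_shift[OF T per', of 0]
      by (simp add: Y_def TS)
    then show ?thesis using injT by simp
  qed
  show thesis
  proof (rule that[of Y])
    show "Y 0 \<phi> = \<phi>" for \<phi> by (simp add: Y_def ST)
    show "((\<lambda>t. Y t \<phi>) has_real_derivative s * v (Y t \<phi>)) (at t)" for t \<phi> by (rule Y1)
    show "y = (\<lambda>t. Y t \<phi>)"
      if y: "y 0 = \<phi>" "\<And>t. (y has_real_derivative s * v (y t)) (at t)" for \<phi> y
    proof
      fix t
      \<comment> \<open>Uniqueness: in the time coordinate every solution is the translation with
        speed \<open>s\<close>.\<close>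
      have "((\<lambda>t. T (y t) - s * t) has_real_derivative 0) (at t)" for t
        using DERIV_chain2[OF T y(2), of t] pos[of "y t"]
        by (auto intro!: derivative_eq_intros)
      then have "T (y t) - s * t = T (y 0) - s * 0"
        using DERIV_isconst_all[of "\<lambda>t. T (y t) - s * t" t 0] by blast
      then show "y t = Y t \<phi>" using y(1) ST by (simp add: Y_def) (metis diff_add_cancel)
    qed
    show "integral {0..2 * pi} (\<lambda>\<phi>. F (Y t \<phi>) * (1 / v \<phi>)) = integral {0..2 * pi} (\<lambda>\<phi>. F \<phi> * (1 / v \<phi>))"
      if F: "continuous_on UNIV F" "\<And>x. F (x + 2 * pi) = F x" for F t
    proof -
      have cG: "continuous_on UNIV (\<lambda>x. F x * (1 / v x))"
        by (intro continuous_intros F cont')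
      obtain P where P: "\<And>x. (P has_real_derivative F x * (1 / v x)) (at x)"
        using antiderivative_on_reals[OF cG] by blast
      \<comment> \<open>Change of variables: the factor \<open>v (Y t \<phi>)\<close> in the
        derivative of the flow cancels the weight in \<open>P'\<close>. By \<open>Y3\<close> the
        image of \<open>{0..2 * pi}\<close> is again one full period.\<close>
      have "((\<lambda>\<phi>. P (Y t \<phi>)) has_real_derivative F (Y t \<phi>) * (1 / v \<phi>)) (at \<phi>)" for \<phi>
        using DERIV_chain2[OF P Y2, of t \<phi>] pos[of "Y t \<phi>"] by simp
      then have "integral {0..2 * pi} (\<lambda>\<phi>. F (Y t \<phi>) * (1 / v \<phi>)) = P (Y t (2 * pi)) - P (Y t 0)"
        using integral_unique[OF integral_antiderivative[of "\<lambda>\<phi>. P (Y t \<phi>)", of _ 0 "2 * pi"]] by simp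
      also have "\<dots> = integral {0..2 * pi} (\<lambda>\<phi>. F \<phi> * (1 / v \<phi>))"
        using antiderivative_shift[OF P, of "Y t 0"] by (simp add: Y3 F per)
      finally show ?thesis .
    qed
  qed
qed

section \<open>The Lambert profile and integrals along the potential\<close>

lemma lambert_W_exp:
  assumes "w \<ge> 0"
  shows "lambert_W (w * exp w) = w"
  unfolding lambert_W_def
proof (rule the_equality)
  fix v :: real
  assume v: "v \<ge> 0 \<and> w * exp w = v * exp v"
  have "a * exp a < b * exp b" if "0 \<le> a" "a < b" for a b :: real
    using that by (intro mult_strict_mono) auto
  then show "v = w" using v assms by (metis linorder_neqE_linordered_idom order_less_irrefl)
qed (use assms in auto)

lemma lambert_W_surj:
  assumes "z > (0::real)"
  obtains w where "w > 0" "w * exp w = z"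
proof -
  have "z * 1 \<le> z * exp z" using assms by (intro mult_left_mono) auto
  moreover have "continuous_on {0..z} (\<lambda>w. w * exp w)" by (intro continuous_intros)
  ultimately obtain w where "0 \<le> w" "w * exp w = z"
    using IVT'[of "\<lambda>w. w * exp w" 0 z z] assms by auto
  moreover from this have "w \<noteq> 0" using assms by auto
  ultimately show thesis using that[of w] by auto
qed

text \<open>\<open>prof k\<close> is the inverse of \<open>g \<mapsto> g\<^sup>2 / 2 + ln g / k\<close> on the positive reals.\<close>

definition prof :: "nat \<Rightarrow> real \<Rightarrow> real" where
  "prof k x = sqrt (lambert_W (exp (2 * x * real k) * real k) / real k)"

text \<open>This is the reciprocal of \<open>g + 1 / (k * g)\<close>, the derivative of
  \<open>g^2 / 2 + ln g / k\<close>, at \<open>g = prof k x\<close>.\<close>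

definition dprof :: "nat \<Rightarrow> real \<Rightarrow> real" where
  "dprof k x = real k * prof k x / (real k * (prof k x)\<^sup>2 + 1)"

lemma gam_prof: "gam f k c \<phi> = prof k (c - f \<phi>)"
  by (simp add: gam_def prof_def)

context
  fixes k :: nat
  assumes k: "k > 0"
begin

text \<open>Doubling the argument and multiplying it by \<open>k\<close> gives
  \<open>k * g^2 + ln (g^2)\<close>, so the Lambert function is evaluated at
  \<open>w * exp w\<close> with \<open>w = k * g^2\<close>.\<close>

lemma prof_unique:
  assumes "g > 0"
  shows "prof k (g\<^sup>2 / 2 + ln g / real k) = g"
proof -
  have "2 * (g\<^sup>2 / 2 + ln g / real k) * real k = real k * g\<^sup>2 + ln (g\<^sup>2)"
    using k assms by (simp add: field_simps ln_realpow)
  then have "exp (2 * (g\<^sup>2 / 2 + ln g / real k) * real k) * real k = real k * g\<^sup>2 * exp (real k * g\<^sup>2)"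
    using assms by (simp add: exp_add)
  then show ?thesis
    using assms k lambert_W_exp[of "real k * g\<^sup>2"]
    unfolding prof_def by (simp only:) simp
qed

text \<open>The equation is the logarithm of the Lambert equation for \<open>w = k * g^2\<close>, in
  which the two terms \<open>ln k\<close> cancel.\<close>

lemma prof_pos_eq: "prof k x > 0 \<and> (prof k x)\<^sup>2 / 2 + ln (prof k x) / real k = x"
proof -
  obtain w where w: "w > 0" "w * exp w = exp (2 * x * real k) * real k"
    using lambert_W_surj[of "exp (2 * x * real k) * real k"] k by auto
  define g where "g = sqrt (w / real k)"
  have g: "g > 0" using w k by (simp add: g_def)
  have "ln w + w = 2 * x * real k + ln (real k)"
    using arg_cong[OF w(2), of ln] w(1) k by (simp add: ln_mult)
  moreover have "2 * ln g = ln w - ln (real k)"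
    using w k by (simp add: g_def ln_sqrt ln_div)
  moreover have "g\<^sup>2 = w / real k" using w k by (simp add: g_def)
  ultimately have "g\<^sup>2 / 2 + ln g / real k = x"
    using k by (simp add: field_simps)
  then show ?thesis using prof_unique[OF g] g by simp
qed

lemmas prof_pos = prof_pos_eq[THEN conjunct1]
lemmas prof_eq = prof_pos_eq[THEN conjunct2]

lemma prof_has_derivative: "(prof k has_real_derivative dprof k x) (at x)"
proof -
  have "(prof k has_real_derivative 1 / (prof k x + 1 / (real k * prof k x)))
    (at ((prof k x)\<^sup>2 / 2 + ln (prof k x) / real k))"
  proof (rule inverse_has_real_derivative[where S = "{0<..}" and F' = "\<lambda>z. z + 1 / (real k * z)"
        and F = "\<lambda>g. g\<^sup>2 / 2 + ln g / real k" and x = "prof k x"])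
    show "((\<lambda>g. g\<^sup>2 / 2 + ln g / real k) has_real_derivative z + 1 / (real k * z)) (at z)"
      if "z \<in> {0<..}" for z
      using that k by (auto intro!: derivative_eq_intros simp: field_simps)
    show "prof k x + 1 / (real k * prof k x) \<noteq> 0"
      using k prof_pos[of x] by (metis add_pos_pos divide_pos_pos less_irrefl mult_pos_pos of_nat_0_less_iff zero_less_one)
  qed (use prof_pos prof_unique in auto)
  moreover have "1 / (prof k x + 1 / (real k * prof k x)) = dprof k x"
    using k prof_pos[of x] by (simp add: dprof_def field_simps power2_eq_square)
  ultimately show ?thesis by (simp add: prof_eq)
qed

lemma continuous_on_prof: "continuous_on UNIV (prof k)"
  using prof_has_derivative DERIV_isCont continuous_at_imp_continuous_on by blast

lemma prof_denom_pos: "real k * (prof k x)\<^sup>2 + 1 > 0"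
  by (smt (verit) mult_nonneg_nonneg of_nat_0_le_iff zero_le_power2)

lemma continuous_on_dprof: "continuous_on UNIV (dprof k)"
  unfolding dprof_def using prof_denom_pos
  by (intro continuous_intros continuous_on_prof) (metis less_irrefl)

lemma dprof_pos: "dprof k x > 0"
  using k prof_pos prof_denom_pos by (simp add: dprof_def)

lemma prof_strict_mono:
  assumes "x < y"
  shows "prof k x < prof k y"
  using assms
proof (rule DERIV_pos_imp_increasing)
  show "\<exists>d. (prof k has_real_derivative d) (at z) \<and> 0 < d" for z
    using prof_has_derivative dprof_pos by blast
qed

lemma prof_mono: "x \<le> y \<Longrightarrow> prof k x \<le> prof k y"
  using prof_strict_mono[of x y] by (cases "x = y") auto

text \<open>The term \<open>ln g / k\<close> is nonpositive for \<open>g < 1\<close> and nonnegative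
  for \<open>g > 1\<close>, so in each bound either 1 already suffices or the logarithm has the
  favourable sign. The bounds are the same for all \<open>k\<close>, as dominated convergence
  requires.\<close>

lemma prof_bounds:
  assumes "0 < a" "a \<le> x" "x \<le> b"
  shows "min 1 (sqrt (2 * a)) \<le> prof k x" "prof k x \<le> max 1 (sqrt (2 * b))"
proof -
  let ?g = "prof k x"
  have g: "?g > 0" "?g\<^sup>2 / 2 + ln ?g / real k = x" by (rule prof_pos prof_eq)+
  show "min 1 (sqrt (2 * a)) \<le> ?g"
  proof (cases "?g \<ge> 1")
    case False
    then have "ln ?g / real k \<le> 0" using g(1) k by (simp add: divide_nonpos_pos)
    then have "2 * a \<le> ?g\<^sup>2" using g(2) assms by simp
    then have "sqrt (2 * a) \<le> ?g" using g(1) by (simp add: real_le_lsqrt)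
    then show ?thesis by simp
  qed simp
  show "?g \<le> max 1 (sqrt (2 * b))"
  proof (cases "?g \<le> 1")
    case False
    then have "ln ?g / real k \<ge> 0" by simp
    then have "?g\<^sup>2 \<le> 2 * b" using g(2) assms by simp
    then have "?g \<le> sqrt (2 * b)" using g(1) by (simp add: real_le_rsqrt)
    then show ?thesis by simp
  qed simp
qed

end

text \<open>Uniform bounds on the profile keep its logarithm bounded, so \<open>ln g / k\<close>
  disappears from the equation. The argument may vary with \<open>k\<close> because the level
  \<open>ck f k J\<close> does.\<close>

lemma prof_tendsto:
  assumes X: "X \<longlonglongrightarrow> x" and x: "x > 0"
  shows "(\<lambda>k. prof k (X k)) \<longlonglongrightarrow> sqrt (2 * x)"
proof -
  define a b where "a = min 1 (sqrt (2 * (x / 2)))" and "b = max 1 (sqrt (2 * (2 * x)))"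
  have a: "a > 0" using x by (simp add: a_def)
  define C where "C = \<bar>ln a\<bar> + \<bar>ln b\<bar>"
  have evX: "\<forall>\<^sub>F k in sequentially. x / 2 < X k \<and> X k < 2 * x"
    using order_tendstoD[OF X, of "x / 2"] order_tendstoD(2)[OF X, of "2 * x"] x
    by (auto simp: eventually_conj_iff)
  have ev: "\<forall>\<^sub>F k in sequentially. \<bar>ln (prof k (X k))\<bar> \<le> C \<and> prof k (X k) > 0 \<and>
      (prof k (X k))\<^sup>2 = 2 * X k - 2 * (ln (prof k (X k)) / real k)"
    using evX eventually_gt_at_top[of 0]
  proof eventually_elim
    case (elim k)
    have "a \<le> prof k (X k)" "prof k (X k) \<le> b"
      using prof_bounds[of k "x / 2" "X k" "2 * x"] elim x by (auto simp: a_def b_def)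
    then have "ln a \<le> ln (prof k (X k))" "ln (prof k (X k)) \<le> ln b"
      using a by auto
    then have "\<bar>ln (prof k (X k))\<bar> \<le> C" unfolding C_def by linarith
    then show ?case using prof_pos[of k "X k"] prof_eq[of k "X k"] elim by (auto simp: algebra_simps)
  qed
  have "(\<lambda>k. ln (prof k (X k)) / real k) \<longlonglongrightarrow> 0"
  proof (rule Lim_null_comparison)
    show "\<forall>\<^sub>F k in sequentially. norm (ln (prof k (X k)) / real k) \<le> C / real k"
      using ev by eventually_elim (auto simp: divide_right_mono)
    show "(\<lambda>k. C / real k) \<longlonglongrightarrow> 0" by (rule lim_const_over_n)
  qed
  then have "(\<lambda>k. 2 * X k - 2 * (ln (prof k (X k)) / real k)) \<longlonglongrightarrow> 2 * x - 2 * 0"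
    by (intro tendsto_intros X)
  then have "(\<lambda>k. sqrt (2 * X k - 2 * (ln (prof k (X k)) / real k))) \<longlonglongrightarrow> sqrt (2 * x)"
    by (auto intro!: tendsto_real_sqrt)
  then show ?thesis
  proof (rule Lim_transform_eventually)
    show "\<forall>\<^sub>F k in sequentially. sqrt (2 * X k - 2 * (ln (prof k (X k)) / real k)) = prof k (X k)"
      using ev
    proof eventually_elim
      case (elim k)
      then show ?case by (metis less_imp_le real_sqrt_unique)
    qed
  qed
qed

section \<open>Integrals depending on a level as parameter\<close>

lemma continuous_on_compose_shift:
  fixes F f :: "real \<Rightarrow> real"
  assumes "continuous_on UNIV F" "continuous_on UNIV f"
  shows "continuous_on S (\<lambda>x. F (c - f x))"
  by (rule continuous_on_compose2[OF assms(1)])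
     (auto intro!: continuous_intros continuous_on_subset[OF assms(2)])

lemma shifted_integral_continuous:
  fixes F f w :: "real \<Rightarrow> real"
  assumes F: "continuous_on UNIV F" and f: "continuous_on UNIV f" and w: "continuous_on UNIV w"
  shows "continuous_on U (\<lambda>c. integral {a..b} (\<lambda>x. w x * F (c - f x)))"
proof -
  have "continuous_on (U \<times> cbox a b) (\<lambda>(c, x). w x * F (c - f x))"
    unfolding split_beta
    by (intro continuous_on_mult continuous_on_compose2[OF F] continuous_on_compose2[OF w]
          continuous_on_diff continuous_on_compose2[OF f] continuous_on_fst continuous_on_snd
          continuous_on_id) auto
  then show ?thesis using integral_continuous_on_param[of U a b] by simp
qed

text \<open>The weight \<open>w\<close> is there for the generating function, where both the
  constant 1 and \<open>2 * pi - x\<close> occur.\<close>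

lemma shifted_integral_has_derivative:
  fixes F f w :: "real \<Rightarrow> real"
  assumes F: "\<And>x. (F has_real_derivative F' x) (at x)" "continuous_on UNIV F'"
    and f: "continuous_on UNIV f" and w: "continuous_on UNIV w"
  shows "((\<lambda>c. integral {a..b} (\<lambda>x. w x * F (c - f x))) has_real_derivative
    integral {a..b} (\<lambda>x. w x * F' (c - f x))) (at c)"
proof -
  have cF: "continuous_on UNIV F"
    using F(1) DERIV_isCont continuous_at_imp_continuous_on by blast
  have "((\<lambda>c. integral (cbox a b) (\<lambda>x. w x * F (c - f x))) has_real_derivative
    integral (cbox a b) (\<lambda>x. w x * F' (c - f x))) (at c within UNIV)"
  proof (rule leibniz_rule_field_derivative)
    show "((\<lambda>c. w t * F (c - f t)) has_real_derivative w t * F' (x - f t)) (at x within UNIV)" for x t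
      by (intro DERIV_cmult DERIV_cong[OF DERIV_chain2[OF F(1), of "\<lambda>c. c - f t" 1]])
         (auto intro!: derivative_eq_intros)
    show "(\<lambda>t. w t * F (x - f t)) integrable_on cbox a b" for x
      by (intro integrable_continuous continuous_on_mult continuous_on_compose_shift cF f
            continuous_on_subset[OF w]) auto
    show "continuous_on (UNIV \<times> cbox a b) (\<lambda>(c, x). w x * F' (c - f x))"
      unfolding split_beta
      by (intro continuous_on_mult continuous_on_compose2[OF F(2)] continuous_on_compose2[OF w]
          continuous_on_diff continuous_on_compose2[OF f] continuous_on_fst continuous_on_snd
          continuous_on_id) auto
  qed auto
  then show ?thesis by simp
qed

text \<open>Integration by parts with \<open>(b - y) * P y\<close>, which vanishes at both ends. It
  turns the normalising double integral of the generating function into a single integral that can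
  be differentiated in the level.\<close>

lemma iterated_integral_weight:
  fixes p :: "real \<Rightarrow> real"
  assumes "continuous_on UNIV p" "b \<ge> 0"
  shows "integral {0..b} (\<lambda>y. integral {0..y} p) = integral {0..b} (\<lambda>x. (b - x) * p x)"
proof -
  obtain P where P: "P 0 = 0" "\<And>x. (P has_real_derivative p x) (at x)"
    using antiderivative_on_reals[OF assms(1)] by blast
  have eq: "integral {0..y} p = P y" if "y \<ge> 0" for y
    using integral_unique[OF integral_antiderivative[OF P(2) that]] P(1) by simp
  have cP: "continuous_on UNIV P"
    using P(2) DERIV_isCont continuous_at_imp_continuous_on by blast
  have "((\<lambda>y. (b - y) * P y) has_real_derivative (b - y) * p y - P y) (at y)" for y
    by (auto intro!: derivative_eq_intros P)
  from integral_antiderivative[OF this assms(2)]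
  have 1: "((\<lambda>y. (b - y) * p y - P y) has_integral 0) {0..b}"
    by (simp add: P(1))
  have 2: "(P has_integral integral {0..b} P) {0..b}"
    by (intro integrable_integral integrable_continuous_interval continuous_on_subset[OF cP]) auto
  have "integral {0..b} (\<lambda>x. (b - x) * p x) = integral {0..b} P"
    using has_integral_add[OF 1 2] by (simp add: integral_unique)
  moreover have "integral {0..b} (\<lambda>y. integral {0..y} p) = integral {0..b} P"
    by (rule integral_cong) (simp add: eq)
  ultimately show ?thesis by simp
qed

lemma integral_pos_continuous:
  fixes p :: "real \<Rightarrow> real"
  assumes cont: "continuous_on {a..b} p" and "a < b"
    and nonneg: "\<And>x. x \<in> {a..b} \<Longrightarrow> p x \<ge> 0" and "x\<^sub>0 \<in> {a..b}" "p x\<^sub>0 \<noteq> 0"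
  shows "integral {a..b} p > 0"
proof -
  have "integral {a..b} p \<ge> 0"
    by (intro integral_nonneg integrable_continuous_interval cont nonneg)
  moreover have "integral {a..b} p \<noteq> 0"
    using integral_eq_0_iff[OF cont \<open>a < b\<close> nonneg] assms(4,5) by blast
  ultimately show ?thesis by simp
qed

section \<open>The action and its inverse\<close>

lemma abs_has_real_derivative:
  fixes x :: real
  assumes "x \<noteq> 0"
  shows "(abs has_real_derivative sgn x) (at x)"
proof (cases "x > 0")
  case True
  have "((\<lambda>x. x) has_real_derivative sgn x) (at x)"
    using True by simp
  then show ?thesis
    by (rule has_field_derivative_transform_within_open[where S = "{0<..}"]) (use True in auto)
next
  case False
  have "((\<lambda>x. - x) has_real_derivative sgn x) (at x)"
    using False assms by (auto intro!: derivative_eq_intros)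
  then show ?thesis
    by (rule has_field_derivative_transform_within_open[where S = "{..<0}"]) (use False assms in auto)
qed

locale circle_potential =
  fixes f :: "real \<Rightarrow> real"
  assumes C2: "C2_circle f"
begin

lemma f_periodic: "f (x + 2 * pi) = f x"
  using C2 by (simp add: C2_circle_def)

lemma f_has_derivative: "(f has_real_derivative deriv f x) (at x)"
  using C2 unfolding C2_circle_def
  by (metis DERIV_imp_deriv real_differentiable_def)

lemma continuous_on_f: "continuous_on S f"
  using f_has_derivative by (meson DERIV_continuous_on has_field_derivative_at_within)

lemma continuous_on_deriv_f: "continuous_on S (deriv f)"
proof -
  have "isCont (deriv f) x" for x
    using C2 by (simp add: C2_circle_def differentiable_imp_continuous_within)
  then show ?thesis by (simp add: continuous_at_imp_continuous_on)
qed

lemma deriv_f_periodic: "deriv f (x + 2 * pi) = deriv f x"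
proof -
  have "((\<lambda>x. f (x + 2 * pi)) has_real_derivative deriv f (x + 2 * pi)) (at x)"
    using f_has_derivative[of "x + 2 * pi"] by (simp add: DERIV_shift)
  then show ?thesis by (simp add: f_periodic DERIV_imp_deriv)
qed

end

text \<open>The action as a function of the level; \<open>ck f k\<close> is its inverse on the
  positive reals.\<close>

definition action :: "(real \<Rightarrow> real) \<Rightarrow> nat \<Rightarrow> real \<Rightarrow> real" where
  "action f k c = 1 / (2 * pi) * integral {0..2 * pi} (\<lambda>\<phi>. prof k (c - f \<phi>))"

definition daction :: "(real \<Rightarrow> real) \<Rightarrow> nat \<Rightarrow> real \<Rightarrow> real" where
  "daction f k c = 1 / (2 * pi) * integral {0..2 * pi} (\<lambda>\<phi>. dprof k (c - f \<phi>))"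

text \<open>Equal to \<open>1 - prof k x * dprof k x\<close>, the defect by which the derivative of
  half the squared profile differs from 1.\<close>

definition wp :: "nat \<Rightarrow> real \<Rightarrow> real" where
  "wp k x = 1 / (real k * (prof k x)\<^sup>2 + 1)"

text \<open>Moments of \<open>wp\<close> against the invariant measure before normalisation;
  \<open>mom f k 0\<close> is the normalising constant of \<open>sigma\<close>.\<close>

definition mom :: "(real \<Rightarrow> real) \<Rightarrow> nat \<Rightarrow> nat \<Rightarrow> real \<Rightarrow> real" where
  "mom f k i c = integral {0..2 * pi} (\<lambda>\<phi>. wp k (c - f \<phi>) ^ i / prof k (c - f \<phi>))"

definition var :: "(real \<Rightarrow> real) \<Rightarrow> nat \<Rightarrow> real \<Rightarrow> real" where
  "var f k c = integral {0..2 * pi}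
     (\<lambda>\<phi>. (wp k (c - f \<phi>) - mom f k 1 c / mom f k 0 c)\<^sup>2 / prof k (c - f \<phi>)) / mom f k 0 c"

locale circle_potential_k = circle_potential +
  fixes k :: nat
  assumes k: "k > 0"
begin

abbreviation "g c \<phi> \<equiv> prof k (c - f \<phi>)"
abbreviation "dg c \<phi> \<equiv> dprof k (c - f \<phi>)"

lemma g_pos: "g c \<phi> > 0"
  by (rule prof_pos[OF k])

lemma g_nonzero: "g c \<phi> \<noteq> 0"
  using g_pos by (metis less_irrefl)

lemma denom_nonzero: "real k * (prof k x)\<^sup>2 + 1 \<noteq> 0"
  using prof_denom_pos[OF k] by (metis less_irrefl)

lemma continuous_on_g: "continuous_on S (g c)"
  by (rule continuous_on_compose_shift[OF continuous_on_prof[OF k] continuous_on_f])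

lemma continuous_on_dg: "continuous_on S (dg c)"
  by (rule continuous_on_compose_shift[OF continuous_on_dprof[OF k] continuous_on_f])

lemma continuous_on_wp: "continuous_on UNIV (wp k)"
  unfolding wp_def by (intro continuous_intros continuous_on_prof[OF k] ballI denom_nonzero)

lemma continuous_on_wpf: "continuous_on S (\<lambda>\<phi>. wp k (c - f \<phi>))"
  by (rule continuous_on_compose_shift[OF continuous_on_wp continuous_on_f])

lemma wp_eq: "wp k x = 1 - prof k x * dprof k x"
  using denom_nonzero by (simp add: wp_def dprof_def field_simps power2_eq_square)

lemma wp_div_prof: "wp k x / prof k x = dprof k x / (real k * (prof k x)\<^sup>2)"
  using prof_pos[OF k] k by (simp add: wp_def dprof_def power2_eq_square)

lemmas continuous_g_intros =
  continuous_intros continuous_on_g continuous_on_dg continuous_on_wpf continuous_on_deriv_f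

lemma action_has_derivative: "(action f k has_real_derivative daction f k c) (at c)"
proof -
  have "((\<lambda>c. integral {0..2 * pi} (\<lambda>\<phi>. 1 * prof k (c - f \<phi>))) has_real_derivative
    integral {0..2 * pi} (\<lambda>\<phi>. 1 * dprof k (c - f \<phi>))) (at c)"
    by (intro shifted_integral_has_derivative prof_has_derivative continuous_on_dprof k
          continuous_on_f continuous_intros)
  from DERIV_cmult[OF this, of "1 / (2 * pi)"] show ?thesis
    by (simp add: action_def[abs_def] daction_def)
qed

lemma continuous_on_daction: "continuous_on S (daction f k)"
  using shifted_integral_continuous[OF continuous_on_dprof[OF k] continuous_on_f continuous_on_const[of _ 1]]
  unfolding daction_def[abs_def] by (intro continuous_intros) simp

lemma integral_g_pos: "integral {0..2 * pi} (g c) > 0"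
  by (rule integral_pos_continuous[where x\<^sub>0 = 0])
     (auto intro!: continuous_on_g g_nonzero less_imp_le[OF g_pos])

lemma daction_pos: "daction f k c > 0"
proof -
  have "integral {0..2 * pi} (dg c) > 0"
    using dprof_pos[OF k, of "c - f 0"]
    by (intro integral_pos_continuous[where x\<^sub>0 = 0] continuous_on_dg)
       (auto intro!: less_imp_le dprof_pos k)
  then show ?thesis by (simp add: daction_def)
qed

lemma action_strict_mono: "c < c' \<Longrightarrow> action f k c < action f k c'"
  using action_has_derivative daction_pos by (metis DERIV_pos_imp_increasing)

lemma action_inj: "action f k c = action f k c' \<longleftrightarrow> c = c'"
  using action_strict_mono by (metis less_irrefl linorder_neqE_linordered_idom)

lemma action_pos: "action f k c > 0"
  using integral_g_pos by (simp add: action_def)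

lemma action_surj:
  assumes "J > 0"
  shows "\<exists>c. action f k c = J"
proof -
  obtain x\<^sub>0 x\<^sub>1 where x: "\<And>x. f x\<^sub>0 \<le> f x" "\<And>x. f x \<le> f x\<^sub>1"
    using periodic_attains_inf[of f, OF continuous_on_f f_periodic]
      periodic_attains_sup[of f, OF continuous_on_f f_periodic] by blast
  \<comment> \<open>The profile takes the value \<open>J\<close> at \<open>x\<close>. Adding the
    minimum of \<open>f\<close> to the level keeps the profile at most \<open>J\<close> everywhere,
    adding the maximum keeps it at least \<open>J\<close>.\<close>
  define x where "x = J\<^sup>2 / 2 + ln J / real k"
  have J: "prof k x = J" using prof_unique[OF k assms] by (simp add: x_def)
  have int: "g c integrable_on {0..2 * pi}" for c
    by (intro integrable_continuous_interval continuous_on_g)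
  have "integral {0..2 * pi} (g (x + f x\<^sub>0)) \<le> integral {0..2 * pi} (\<lambda>_. J)"
    using prof_mono[OF k, of _ x] x(1) J by (intro integral_le int) auto
  then have "action f k (x + f x\<^sub>0) \<le> J"
    by (simp add: action_def field_simps)
  moreover have "integral {0..2 * pi} (g (x + f x\<^sub>1)) \<ge> integral {0..2 * pi} (\<lambda>_. J)"
    using prof_mono[OF k, of x] x(2) J by (intro integral_le int) auto
  then have "J \<le> action f k (x + f x\<^sub>1)"
    by (simp add: action_def field_simps)
  moreover have "\<forall>c. isCont (action f k) c"
    using action_has_derivative DERIV_isCont by blast
  ultimately show ?thesis
    using IVT[of "action f k" "x + f x\<^sub>0" J "x + f x\<^sub>1"] x(1)[of x\<^sub>1] by auto
qed

lemma ck_action: "ck f k (action f k c) = c"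
  unfolding ck_def gam_prof action_def[symmetric] by (simp add: action_inj)

lemma action_ck: "J > 0 \<Longrightarrow> action f k (ck f k J) = J"
  using action_surj ck_action by metis

lemma ck_has_derivative:
  assumes "J > 0"
  shows "(ck f k has_real_derivative 1 / daction f k (ck f k J)) (at J)"
proof -
  have "(ck f k has_real_derivative 1 / daction f k (ck f k J)) (at (action f k (ck f k J)))"
    by (rule inverse_has_real_derivative[where S = UNIV])
       (use action_has_derivative ck_action daction_pos in \<open>auto simp: less_imp_neq[symmetric]\<close>)
  then show ?thesis by (simp add: action_ck[OF assms])
qed

section \<open>The generating function and its derivatives\<close>

text \<open>Both integrals now have the weighted form whose derivative in the level is known; the
  factor 1 in the last one is its weight.\<close>

lemma u_pos_eq:
  "u_pos f k J \<phi> = J * (pi - \<phi> rmod (2 * pi))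
     - 1 / (2 * pi) * integral {0..2 * pi} (\<lambda>x. (2 * pi - x) * g (ck f k J) x)
     + integral {0..\<phi> rmod (2 * pi)} (\<lambda>x. 1 * g (ck f k J) x)"
  unfolding u_pos_def gam_prof
  by (subst iterated_integral_weight) (auto intro: continuous_on_g)

text \<open>Neither the sawtooth nor the integral of the profile is differentiable at the multiples
  of \<open>2 * pi\<close>. Their jumps cancel: \<open>J\<close> is the mean of the profile at level
  \<open>ck f k J\<close>, so the combined integrand has mean zero.\<close>

lemma u_pos_has_derivative:
  assumes J: "J > 0"
  shows "(u_pos f k J has_real_derivative g (ck f k J) \<phi> - J) (at \<phi>)"
proof -
  let ?c = "ck f k J"
  have "((\<lambda>\<phi>. integral {0..\<phi> rmod (2 * pi)} (\<lambda>x. g ?c x - J)) has_real_derivative g ?c \<phi> - J) (at \<phi>)"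
  proof (rule integral_rmod_has_derivative)
    show "integral {0..2 * pi} (\<lambda>x. g ?c x - J) = 0"
      using action_ck[OF J]
      by (subst integral_diff) (auto intro!: integrable_continuous_interval continuous_on_g
        simp: action_def field_simps)
  qed (auto intro!: continuous_g_intros simp: f_periodic)
  moreover have "integral {0..\<phi> rmod (2 * pi)} (\<lambda>x. g ?c x - J) =
    integral {0..\<phi> rmod (2 * pi)} (g ?c) - \<phi> rmod (2 * pi) * J" for \<phi>
    using rmod_circle_bounds[of \<phi>]
    by (subst integral_diff) (auto intro!: integrable_continuous_interval continuous_on_g)
  ultimately have "((\<lambda>\<phi>. integral {0..\<phi> rmod (2 * pi)} (g ?c) - \<phi> rmod (2 * pi) * J +
     (J * pi - 1 / (2 * pi) * integral {0..2 * pi} (\<lambda>x. (2 * pi - x) * g ?c x)))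
      has_real_derivative g ?c \<phi> - J + 0) (at \<phi>)"
    by (intro DERIV_add DERIV_const) simp
  then show ?thesis by (simp add: u_pos_eq[abs_def] algebra_simps)
qed

text \<open>The derivative of \<open>u_pos\<close> in the action. The linear part of the sawtooth is
  absorbed as the \<open>- 1\<close> in the last integrand, which gives that integrand mean zero and
  makes \<open>du\<close> differentiable in the angle.\<close>

definition du :: "real \<Rightarrow> real \<Rightarrow> real" where
  "du J \<phi> = (pi - 1 / (2 * pi) * integral {0..2 * pi} (\<lambda>x. (2 * pi - x) * dg (ck f k J) x) / daction f k (ck f k J))
      + integral {0..\<phi> rmod (2 * pi)} (\<lambda>x. dg (ck f k J) x / daction f k (ck f k J) - 1)"

lemma u_pos_has_derivative_action:
  assumes J: "J > 0"
  shows "((\<lambda>I. u_pos f k I \<phi>) has_real_derivative du J \<phi>) (at J)"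
proof -
  let ?c = "ck f k J" and ?r = "\<phi> rmod (2 * pi)"
  have *: "((\<lambda>I. integral {0..b} (\<lambda>x. w x * g (ck f k I) x)) has_real_derivative
    integral {0..b} (\<lambda>x. w x * dg ?c x) * (1 / daction f k ?c)) (at J)"
    if "continuous_on UNIV w" for b w
    by (rule DERIV_chain2[OF _ ck_has_derivative[OF J]], rule shifted_integral_has_derivative)
       (intro prof_has_derivative continuous_on_dprof k continuous_on_f that)+
  have "du J \<phi> = (pi - ?r) - 1 / (2 * pi) * (integral {0..2 * pi} (\<lambda>x. (2 * pi - x) * dg ?c x) * (1 / daction f k ?c))
    + integral {0..?r} (\<lambda>x. 1 * dg ?c x) * (1 / daction f k ?c)"
    unfolding du_def using rmod_circle_bounds[of \<phi>] daction_pos[of ?c]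
    by (subst integral_diff) (auto intro!: integrable_continuous_interval continuous_g_intros)
  moreover have "((\<lambda>I. I * (pi - ?r)) has_real_derivative (pi - ?r)) (at J)"
    by (auto intro!: derivative_eq_intros)
  ultimately show ?thesis
    unfolding u_pos_eq[abs_def]
    by (simp only:) (intro DERIV_add DERIV_diff DERIV_cmult * continuous_intros; assumption)
qed

lemma du_has_derivative:
  assumes J: "J > 0"
  shows "(du J has_real_derivative dg (ck f k J) \<phi> / daction f k (ck f k J) - 1) (at \<phi>)"
proof -
  let ?c = "ck f k J"
  have "integral {0..2 * pi} (\<lambda>x. dg ?c x / daction f k ?c - 1) = 0"
    using daction_pos[of ?c]
    by (subst integral_diff)
       (auto intro!: integrable_continuous_interval continuous_g_intros simp: daction_def)
  then have "((\<lambda>\<phi>. integral {0..\<phi> rmod (2 * pi)} (\<lambda>x. dg ?c x / daction f k ?c - 1))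
     has_real_derivative dg ?c \<phi> / daction f k ?c - 1) (at \<phi>)"
    using daction_pos[of ?c]
    by (intro integral_rmod_has_derivative) (auto intro!: continuous_g_intros simp: f_periodic)
  from DERIV_add[OF DERIV_const this] show ?thesis
    unfolding du_def[abs_def] by simp
qed

lemma u_\<phi>_eq:
  assumes "J \<noteq> 0"
  shows "u_\<phi> f k J \<phi> = sgn J * g (ck f k \<bar>J\<bar>) \<phi> - J"
proof -
  have "(u_gen f k J has_real_derivative sgn J * g (ck f k \<bar>J\<bar>) \<phi> - J) (at \<phi>)"
    using u_pos_has_derivative[of "\<bar>J\<bar>" \<phi>] assms DERIV_minus[OF u_pos_has_derivative[of "\<bar>J\<bar>" \<phi>]]
    by (cases "J < 0") (auto simp: u_gen_def[abs_def])
  then show ?thesis unfolding u_\<phi>_def by (simp add: DERIV_imp_deriv)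
qed

text \<open>The generating function is odd in the action, hence this derivative is even. Its case
  distinction on the sign is constant near \<open>J\<close>, so each half line is treated by
  transforming the derivative on an open set.\<close>

lemma u_J_eq:
  assumes "J \<noteq> 0"
  shows "u_J f k J \<phi> = du \<bar>J\<bar> \<phi>"
proof -
  have "((\<lambda>I. u_gen f k I \<phi>) has_real_derivative du \<bar>J\<bar> \<phi>) (at J)"
  proof (cases "J > 0")
    case True
    then have "((\<lambda>I. u_pos f k I \<phi>) has_real_derivative du \<bar>J\<bar> \<phi>) (at J)"
      using u_pos_has_derivative_action[of J \<phi>] by simp
    then show ?thesis
      by (rule has_field_derivative_transform_within_open[where S = "{0<..}"])
         (use True in \<open>auto simp: u_gen_def\<close>)
  next
    case False
    then have J: "J < 0" using assms by simp
    have "((\<lambda>I. - u_pos f k (- I) \<phi>) has_real_derivative - (du (- J) \<phi> * - 1)) (at J)"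
      using J by (intro DERIV_minus DERIV_chain2[OF u_pos_has_derivative_action])
        (auto intro!: derivative_eq_intros)
    then have "((\<lambda>I. - u_pos f k (- I) \<phi>) has_real_derivative du \<bar>J\<bar> \<phi>) (at J)"
      using J by simp
    then show ?thesis
      by (rule has_field_derivative_transform_within_open[where S = "{..<0}"])
         (use J in \<open>auto simp: u_gen_def\<close>)
  qed
  then show ?thesis unfolding u_J_def by (rule DERIV_imp_deriv)
qed

section \<open>Moments and the derivative of the averaged energy\<close>

lemma mom_0: "mom f k 0 c = integral {0..2 * pi} (\<lambda>\<phi>. 1 / g c \<phi>)"
  by (simp add: mom_def)

lemma mom_0_pos: "mom f k 0 c > 0"
  unfolding mom_0
  by (rule integral_pos_continuous[where x\<^sub>0 = 0])
     (auto intro!: continuous_g_intros g_nonzero less_imp_le[OF g_pos])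

lemma continuous_on_mom: "continuous_on S (mom f k i)"
proof -
  have "continuous_on UNIV (\<lambda>x. wp k x ^ i / prof k x)"
    using prof_pos[OF k]
    by (intro continuous_intros continuous_on_wp continuous_on_prof[OF k]) (metis less_irrefl)
  from shifted_integral_continuous[OF this continuous_on_f continuous_on_const[of _ 1]]
  show ?thesis unfolding mom_def[abs_def] by simp
qed

text \<open>The derivative of \<open>1 / g\<close> in the level is \<open>- k * wp / g\<close>, so
  \<open>k\<close> cancels against the factor \<open>1 / k\<close> of the logarithm and leaves the
  mean of \<open>wp\<close>. The chain rule through \<open>ck\<close> contributes
  \<open>1 / daction\<close>, and the absolute value contributes the sign.\<close>

lemma Hbar_deriv:
  assumes "J \<noteq> 0"
  shows "deriv (Hbar f k) J =
    sgn J * ((1 - mom f k 1 (ck f k \<bar>J\<bar>) / mom f k 0 (ck f k \<bar>J\<bar>)) / daction f k (ck f k \<bar>J\<bar>))"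
proof -
  let ?c = "ck f k \<bar>J\<bar>"
  have d1: "((\<lambda>x. 1 / prof k x) has_real_derivative - (real k * (wp k x / prof k x))) (at x)" for x
    unfolding wp_div_prof using prof_pos[OF k, of x] k
    by (auto intro!: derivative_eq_intros prof_has_derivative simp: power2_eq_square)
  have "((\<lambda>c. integral {0..2 * pi} (\<lambda>\<phi>. 1 * (1 / g c \<phi>))) has_real_derivative
     integral {0..2 * pi} (\<lambda>\<phi>. 1 * - (real k * (wp k (?c - f \<phi>) / g ?c \<phi>)))) (at ?c)"
    using prof_pos[OF k]
    by (intro shifted_integral_has_derivative[where F = "\<lambda>x. 1 / prof k x"] d1 continuous_on_f
      continuous_intros continuous_on_wp continuous_on_prof[OF k]) (metis less_irrefl)
  then have d2: "(mom f k 0 has_real_derivative - (real k * mom f k 1 ?c)) (at ?c)"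
    unfolding mom_0[abs_def] by (simp add: mom_def flip: times_divide_eq_right)
  have "((\<lambda>c. c + 1 / real k * ln (mom f k 0 c)) has_real_derivative 1 - mom f k 1 ?c / mom f k 0 ?c) (at ?c)"
    using mom_0_pos[of ?c] k by (auto intro!: derivative_eq_intros d2 simp: field_simps)
  moreover have "((\<lambda>J. ck f k \<bar>J\<bar>) has_real_derivative 1 / daction f k ?c * sgn J) (at J)"
    using assms
    by (intro DERIV_chain2[OF ck_has_derivative] abs_has_real_derivative) auto
  ultimately have "((\<lambda>J. ck f k \<bar>J\<bar> + 1 / real k * ln (mom f k 0 (ck f k \<bar>J\<bar>))) has_real_derivative
     (1 - mom f k 1 ?c / mom f k 0 ?c) * (1 / daction f k ?c * sgn J)) (at J)"
    by (rule DERIV_chain2[where g = "\<lambda>J. ck f k \<bar>J\<bar>"])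
  then have "(Hbar f k has_real_derivative
     sgn J * ((1 - mom f k 1 ?c / mom f k 0 ?c) / daction f k ?c)) (at J)"
    unfolding Hbar_def[abs_def] gam_prof mom_0 by (simp add: mult.commute)
  then show ?thesis by (rule DERIV_imp_deriv)
qed

end

section \<open>The errors in closed form\<close>

context circle_potential_k
begin

text \<open>By the formula for \<open>u_\<phi>\<close> the velocity is \<open>sgn J\<close> times
  the profile at level \<open>ck f k \<bar>J\<bar>\<close>; a negative action only reverses the
  motion and leaves the invariant measure unchanged.\<close>

lemma flow_facts:
  assumes J: "J \<noteq> 0"
  shows flow_has_derivative:
      "((\<lambda>t. flow f k J t \<phi>) has_real_derivative sgn J * g (ck f k \<bar>J\<bar>) (flow f k J t \<phi>)) (at t)"
    and flow_invariant:
      "continuous_on UNIV F \<Longrightarrow> (\<And>x. F (x + 2 * pi) = F x) \<Longrightarrow>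
       integral {0..2 * pi} (\<lambda>\<phi>. F (flow f k J t \<phi>) * (1 / g (ck f k \<bar>J\<bar>) \<phi>)) =
       integral {0..2 * pi} (\<lambda>\<phi>. F \<phi> * (1 / g (ck f k \<bar>J\<bar>) \<phi>))"
proof -
  let ?c = "ck f k \<bar>J\<bar>"
  obtain Y where Y: "\<And>\<phi>. Y 0 \<phi> = \<phi>"
    "\<And>t \<phi>. ((\<lambda>t. Y t \<phi>) has_real_derivative sgn J * g ?c (Y t \<phi>)) (at t)"
    "\<And>\<phi> y. y 0 = \<phi> \<Longrightarrow> (\<And>t. (y has_real_derivative sgn J * g ?c (y t)) (at t)) \<Longrightarrow> y = (\<lambda>t. Y t \<phi>)"
    "\<And>F t. continuous_on UNIV F \<Longrightarrow> (\<And>x. F (x + 2 * pi) = F x) \<Longrightarrow>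
       integral {0..2 * pi} (\<lambda>\<phi>. F (Y t \<phi>) * (1 / g ?c \<phi>)) = integral {0..2 * pi} (\<lambda>\<phi>. F \<phi> * (1 / g ?c \<phi>))"
    by (rule periodic_flow[of "g ?c" "sgn J", OF continuous_on_g g_pos]) (simp add: f_periodic, blast)
  have "flow f k J t \<phi> = Y t \<phi>" for t \<phi>
  proof -
    \<comment> \<open>Existence and uniqueness of the global solution make the definite description
      denote it.\<close>
    have "(THE y. y 0 = \<phi> \<and> (\<forall>s. (y has_real_derivative J + u_\<phi> f k J (y s)) (at s))) = (\<lambda>t. Y t \<phi>)"
      using Y(1,2,3) by (intro the_equality) (auto simp: u_\<phi>_eq[OF J])
    then show ?thesis by (simp add: flow_def)
  qed
  then have flow: "flow f k J = Y" by (intro ext)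
  show "((\<lambda>t. flow f k J t \<phi>) has_real_derivative sgn J * g ?c (flow f k J t \<phi>)) (at t)"
    unfolding flow by (rule Y(2))
  show "continuous_on UNIV F \<Longrightarrow> (\<And>x. F (x + 2 * pi) = F x) \<Longrightarrow>
       integral {0..2 * pi} (\<lambda>\<phi>. F (flow f k J t \<phi>) * (1 / g ?c \<phi>)) =
       integral {0..2 * pi} (\<lambda>\<phi>. F \<phi> * (1 / g ?c \<phi>))"
    unfolding flow by (rule Y(4))
qed

text \<open>The sign enters once from the action and once from the velocity, and
  \<open>g * dg = 1 - wp\<close>. After adding \<open>deriv f\<close> only
  \<open>deriv f * wp\<close> remains, the quantity squared in \<open>E2\<close>.\<close>

lemma action_t_deriv:
  assumes J: "J \<noteq> 0"
  shows "deriv (action_t f k J \<phi>) t =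
    - deriv f (flow f k J t \<phi>) * (1 - wp k (ck f k \<bar>J\<bar> - f (flow f k J t \<phi>)))"
proof -
  let ?c = "ck f k \<bar>J\<bar>" and ?y = "\<lambda>t. flow f k J t \<phi>"
  have "((\<lambda>t. sgn J * g ?c (?y t)) has_real_derivative
     sgn J * (dg ?c (?y t) * (- (deriv f (?y t) * (sgn J * g ?c (?y t)))))) (at t)"
    by (intro DERIV_cmult DERIV_chain2[OF prof_has_derivative[OF k]])
       (auto intro!: derivative_eq_intros DERIV_chain2[OF f_has_derivative] flow_has_derivative[OF J])
  moreover have "sgn J * (dg ?c (?y t) * (- (deriv f (?y t) * (sgn J * g ?c (?y t))))) =
     - deriv f (?y t) * (1 - wp k (?c - f (?y t)))"
    using J by (simp add: wp_eq sgn_if)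
  moreover have "action_t f k J \<phi> = (\<lambda>t. sgn J * g ?c (?y t))"
    by (intro ext) (simp add: action_t_def u_\<phi>_eq[OF J])
  ultimately show ?thesis by (simp add: DERIV_imp_deriv)
qed

text \<open>The map \<open>\<phi> + du \<bar>J\<bar> \<phi>\<close> has slope
  \<open>dg / daction\<close>, and the flow moves with velocity \<open>sgn J * g\<close>; again
  \<open>g * dg = 1 - wp\<close>.\<close>

lemma angle_t_deriv:
  assumes J: "J \<noteq> 0"
  shows "deriv (angle_t f k J \<phi>) t =
    sgn J * ((1 - wp k (ck f k \<bar>J\<bar> - f (flow f k J t \<phi>))) / daction f k (ck f k \<bar>J\<bar>))"
proof -
  let ?c = "ck f k \<bar>J\<bar>" and ?y = "\<lambda>t. flow f k J t \<phi>"
  have "((\<lambda>\<phi>. \<phi> + du \<bar>J\<bar> \<phi>) has_real_derivative dg ?c \<psi> / daction f k ?c) (at \<psi>)" for \<psi>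
    using DERIV_add[OF DERIV_ident du_has_derivative[of "\<bar>J\<bar>" \<psi>]] J by simp
  then have "((\<lambda>t. ?y t + du \<bar>J\<bar> (?y t)) has_real_derivative
     dg ?c (?y t) / daction f k ?c * (sgn J * g ?c (?y t))) (at t)"
    by (rule DERIV_chain2) (rule flow_has_derivative[OF J])
  moreover have "angle_t f k J \<phi> = (\<lambda>t. ?y t + du \<bar>J\<bar> (?y t))"
    by (intro ext) (simp add: angle_t_def u_J_eq[OF J])
  ultimately show ?thesis by (simp add: DERIV_imp_deriv wp_eq mult.commute)
qed

lemma sigma_eq: "sigma f k J \<phi> = 1 / g (ck f k \<bar>J\<bar>) \<phi> / mom f k 0 (ck f k \<bar>J\<bar>)"
  by (simp add: sigma_def gam_prof mom_0)

lemma E2_eq: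
  assumes J: "J > 0"
  shows "E2 f J k t = integral {0..2 * pi}
      (\<lambda>\<phi>. (deriv f \<phi> * wp k (ck f k J - f \<phi>))\<^sup>2 * (1 / g (ck f k J) \<phi>)) / mom f k 0 (ck f k J)"
proof -
  let ?c = "ck f k J"
  let ?F = "\<lambda>\<phi>. (deriv f \<phi> * wp k (?c - f \<phi>))\<^sup>2"
  have "E2 f J k t = integral {0..2 * pi} (\<lambda>\<phi>. ?F (flow f k J t \<phi>) * (1 / g ?c \<phi>) / mom f k 0 ?c)"
    unfolding E2_def using J
    by (intro integral_cong) (simp add: action_t_deriv sigma_eq algebra_simps)
  also have "\<dots> = integral {0..2 * pi} (\<lambda>\<phi>. ?F (flow f k J t \<phi>) * (1 / g ?c \<phi>)) / mom f k 0 ?c"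
    by (rule integral_divide)
  also have "integral {0..2 * pi} (\<lambda>\<phi>. ?F (flow f k J t \<phi>) * (1 / g ?c \<phi>)) =
    integral {0..2 * pi} (\<lambda>\<phi>. ?F \<phi> * (1 / g ?c \<phi>))"
  proof -
    have "continuous_on UNIV ?F" by (intro continuous_g_intros)
    from flow_invariant[OF _ this, of J t] show ?thesis
      using J by (simp add: f_periodic deriv_f_periodic)
  qed
  finally show ?thesis .
qed

text \<open>The velocity of the angle and the derivative of \<open>Hbar\<close> share the factor
  \<open>sgn J / daction\<close>, and their constant terms cancel. What is left is the deviation of
  \<open>wp\<close> from its mean, and flow invariance removes the time.\<close>

lemma E1_inner_eq:
  assumes J: "J \<noteq> 0"
  shows "integral {0..2 * pi} (\<lambda>\<phi>. \<bar>deriv (angle_t f k J \<phi>) t - deriv (Hbar f k) J\<bar>\<^sup>2 * sigma f k J \<phi>) =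
    var f k (ck f k \<bar>J\<bar>) / (daction f k (ck f k \<bar>J\<bar>))\<^sup>2"
proof -
  let ?c = "ck f k \<bar>J\<bar>" and ?d = "daction f k (ck f k \<bar>J\<bar>)" and ?m = "mom f k 0 (ck f k \<bar>J\<bar>)"
  define F where "F = (\<lambda>\<phi>. (wp k (?c - f \<phi>) - mom f k 1 ?c / ?m)\<^sup>2)"
  have sgn: "(sgn J)\<^sup>2 = 1" using J by (simp add: sgn_if)
  have "\<bar>deriv (angle_t f k J \<phi>) t - deriv (Hbar f k) J\<bar>\<^sup>2 * sigma f k J \<phi> =
     F (flow f k J t \<phi>) * (1 / g ?c \<phi>) / (?m * ?d\<^sup>2)" for \<phi>
  proof -
    have "deriv (angle_t f k J \<phi>) t - deriv (Hbar f k) J =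
       sgn J * ((mom f k 1 ?c / ?m - wp k (?c - f (flow f k J t \<phi>))) / ?d)"
      unfolding angle_t_deriv[OF J] Hbar_deriv[OF J]
      by (simp flip: diff_divide_distrib right_diff_distrib)
    then have "\<bar>deriv (angle_t f k J \<phi>) t - deriv (Hbar f k) J\<bar>\<^sup>2 = F (flow f k J t \<phi>) / ?d\<^sup>2"
      by (simp add: power_mult_distrib power_divide sgn F_def power2_commute)
    then show ?thesis by (simp add: sigma_eq)
  qed
  then have "integral {0..2 * pi} (\<lambda>\<phi>. \<bar>deriv (angle_t f k J \<phi>) t - deriv (Hbar f k) J\<bar>\<^sup>2 * sigma f k J \<phi>) =
     integral {0..2 * pi} (\<lambda>\<phi>. F (flow f k J t \<phi>) * (1 / g ?c \<phi>)) / (?m * ?d\<^sup>2)"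
    by (simp only: integral_divide)
  also have "integral {0..2 * pi} (\<lambda>\<phi>. F (flow f k J t \<phi>) * (1 / g ?c \<phi>)) =
     integral {0..2 * pi} (\<lambda>\<phi>. F \<phi> * (1 / g ?c \<phi>))"
    by (rule flow_invariant[OF J]) (auto intro!: continuous_g_intros simp: f_periodic F_def)
  finally show ?thesis by (simp add: var_def F_def)
qed

section \<open>Variance of the defect and its size near zero action\<close>

text \<open>The centre \<open>m\<close> is free because two values are used: the mean of
  \<open>wp\<close> for the variance, and 1 for the bound near zero action.\<close>

lemma integral_wp_quadratic:
  "integral {0..2 * pi} (\<lambda>\<phi>. (wp k (c - f \<phi>) - m)\<^sup>2 / g c \<phi>) =
    mom f k 2 c - 2 * m * mom f k 1 c + m\<^sup>2 * mom f k 0 c"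
proof -
  have "integral {0..2 * pi} (\<lambda>\<phi>. (wp k (c - f \<phi>) - m)\<^sup>2 / g c \<phi>) =
    integral {0..2 * pi} (\<lambda>\<phi>. wp k (c - f \<phi>) ^ 2 / g c \<phi> - (2 * m) * (wp k (c - f \<phi>) ^ 1 / g c \<phi>)
      + m\<^sup>2 * (wp k (c - f \<phi>) ^ 0 / g c \<phi>))"
    by (intro integral_cong) (simp add: power2_diff diff_divide_distrib add_divide_distrib)
  also have "\<dots> = mom f k 2 c - 2 * m * mom f k 1 c + m\<^sup>2 * mom f k 0 c"
  proof -
    have int: "(\<lambda>\<phi>. wp k (c - f \<phi>) ^ i / g c \<phi>) integrable_on {0..2 * pi}" for i
      by (intro integrable_continuous_interval continuous_g_intros ballI g_nonzero)
    show ?thesis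
      unfolding mom_def using int
      by (simp only: integral_add integral_diff integrable_diff integrable_on_mult_right integral_mult_right)
  qed
  finally show ?thesis .
qed

lemma var_eq: "var f k c = mom f k 2 c / mom f k 0 c - (mom f k 1 c / mom f k 0 c)\<^sup>2"
  unfolding var_def integral_wp_quadratic using mom_0_pos[of c]
  by (simp add: field_simps power2_eq_square)

lemma var_nonneg: "var f k c \<ge> 0"
  unfolding var_def
  by (intro divide_nonneg_pos mom_0_pos integral_nonneg integrable_continuous_interval
      continuous_g_intros ballI g_nonzero zero_le_power2 g_pos)

lemma continuous_on_var: "continuous_on S (var f k)"
  unfolding var_eq[abs_def] using mom_0_pos
  by (intro continuous_intros continuous_on_mom) (metis less_irrefl)+

text \<open>Controls the integrand of \<open>E1\<close> near zero action, where \<open>dc / dJ\<close> blows up.\<close>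

lemma gam_ratio:
  obtains M where "M \<ge> 1" "\<And>c \<phi> \<psi>. g c \<phi> \<le> M * g c \<psi>"
proof -
  obtain x\<^sub>0 x\<^sub>1 where x: "\<And>x. f x\<^sub>0 \<le> f x" "\<And>x. f x \<le> f x\<^sub>1"
    using periodic_attains_inf[of f, OF continuous_on_f f_periodic]
      periodic_attains_sup[of f, OF continuous_on_f f_periodic] by blast
  let ?D = "real k * (f x\<^sub>1 - f x\<^sub>0)"
  have D: "?D \<ge> 0" using x(1)[of x\<^sub>1] by simp
  show thesis
  proof (rule that[of "exp ?D"])
    fix c \<phi> \<psi>
    have "ln (g c \<phi>) \<le> ?D + ln (g c \<psi>)"
    proof (cases "g c \<phi> \<le> g c \<psi>")
      case True
      then have "ln (g c \<phi>) \<le> ln (g c \<psi>)" using g_pos by (simp add: ln_mono)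
      then show ?thesis using D by simp
    next
      case False
      \<comment> \<open>In the difference of the two profile equations the squares have the
        favourable sign, so \<open>k\<close> times the oscillation of \<open>f\<close> bounds the
        difference of the logarithms.\<close>
      then have "(g c \<psi>)\<^sup>2 \<le> (g c \<phi>)\<^sup>2" using g_pos[of c \<psi>] by (intro power_mono) auto
      then have "ln (g c \<phi>) / real k - ln (g c \<psi>) / real k \<le> f \<psi> - f \<phi>"
        using prof_eq[OF k, of "c - f \<phi>"] prof_eq[OF k, of "c - f \<psi>"] by linarith
      also have "\<dots> \<le> f x\<^sub>1 - f x\<^sub>0" using x(1)[of \<phi>] x(2)[of \<psi>] by linarith
      finally show ?thesis using k by (simp add: field_simps)
    qed
    then have "exp (ln (g c \<phi>)) \<le> exp (?D + ln (g c \<psi>))" by simp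
    then show "g c \<phi> \<le> exp ?D * g c \<psi>" using g_pos by (simp add: exp_add)
  qed (use D in auto)
qed

text \<open>The variance is at most the mean of \<open>(1 - wp)^2\<close>. Here
  \<open>1 - wp = g * dg\<close>, where \<open>g\<close> is at most a constant times its mean
  \<open>J\<close> and \<open>dg\<close> at most a constant times its mean \<open>daction\<close>;
  the latter cancels on division.\<close>

lemma integrand_bound:
  obtains M where "\<And>J. J > 0 \<Longrightarrow> var f k (ck f k J) / (daction f k (ck f k J))\<^sup>2 \<le> (M * J)\<^sup>2"
proof -
  obtain M where M: "M \<ge> 1" "\<And>c \<phi> \<psi>. g c \<phi> \<le> M * g c \<psi>"
    using gam_ratio by blast
  have int_le: "x \<le> 1 / (2 * pi) * integral {0..2 * pi} p"
    if "continuous_on {0..2 * pi} p" "\<And>y. x \<le> p y" for x p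
  proof -
    have "integral {0..2 * pi} (\<lambda>_. x) \<le> integral {0..2 * pi} p"
      using that by (intro integral_le integrable_continuous_interval) auto
    then show ?thesis by (simp add: field_simps)
  qed
  \<comment> \<open>In \<open>dg\<close> one factor \<open>M\<close> comes from the numerator and
    two from the square in the denominator.\<close>
  have dg_ratio: "dg c \<phi> \<le> M ^ 3 * dg c \<psi>" for c \<phi> \<psi>
  proof -
    have "(g c \<psi>)\<^sup>2 \<le> (M * g c \<phi>)\<^sup>2"
      using M(2) g_pos by (intro power_mono) (auto intro: less_imp_le)
    then have "real k * (g c \<psi>)\<^sup>2 \<le> real k * (M * g c \<phi>)\<^sup>2"
      by (rule mult_left_mono) simp
    also have "\<dots> = M\<^sup>2 * (real k * (g c \<phi>)\<^sup>2)" by (simp add: power_mult_distrib)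
    finally have "real k * (g c \<psi>)\<^sup>2 + 1 \<le> M\<^sup>2 * (real k * (g c \<phi>)\<^sup>2 + 1)"
      using one_le_power[OF M(1), of 2] unfolding distrib_left by linarith
    then have "g c \<phi> * (real k * (g c \<psi>)\<^sup>2 + 1) \<le> M * g c \<psi> * (M\<^sup>2 * (real k * (g c \<phi>)\<^sup>2 + 1))"
      using M g_pos[of c \<phi>] prof_denom_pos[OF k, of "c - f \<psi>"] by (intro mult_mono) (auto intro: order_trans[OF less_imp_le])
    then have "g c \<phi> / (real k * (g c \<phi>)\<^sup>2 + 1) \<le> M ^ 3 * (g c \<psi> / (real k * (g c \<psi>)\<^sup>2 + 1))"
      using prof_denom_pos[OF k] by (simp add: divide_simps) (simp add: algebra_simps power2_eq_square power3_eq_cube)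
    then have "real k * (g c \<phi> / (real k * (g c \<phi>)\<^sup>2 + 1)) \<le> real k * (M ^ 3 * (g c \<psi> / (real k * (g c \<psi>)\<^sup>2 + 1)))"
      by (rule mult_left_mono) simp
    then show ?thesis by (simp add: dprof_def mult.left_commute)
  qed
  have dg_le: "dg c \<phi> \<le> M ^ 3 * daction f k c" for c \<phi>
    using int_le[of "\<lambda>\<psi>. M ^ 3 * dg c \<psi>", OF _ dg_ratio]
    by (simp add: daction_def continuous_g_intros)
  have g_le: "g c \<phi> \<le> M * action f k c" for c \<phi>
    using int_le[of "\<lambda>\<psi>. M * g c \<psi>", OF _ M(2)]
    by (simp add: action_def continuous_g_intros)
  show thesis
  proof (rule that[of "M ^ 4"])
    fix J :: real
    assume J: "J > 0"
    let ?c = "ck f k J"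
    let ?d = "daction f k ?c" and ?Q = "M ^ 4 * J * daction f k ?c"
    have q: "0 \<le> 1 - wp k (?c - f \<phi>)" "1 - wp k (?c - f \<phi>) \<le> ?Q" for \<phi>
    proof -
      have 0: "0 \<le> g ?c \<phi>" "0 \<le> dg ?c \<phi>" using g_pos[of ?c \<phi>] dprof_pos[OF k, of "?c - f \<phi>"] by auto
      then show "0 \<le> 1 - wp k (?c - f \<phi>)" by (simp add: wp_eq)
      have "1 - wp k (?c - f \<phi>) = g ?c \<phi> * dg ?c \<phi>" by (simp add: wp_eq)
      also have "\<dots> \<le> (M * action f k ?c) * (M ^ 3 * ?d)"
        using 0 g_le[of ?c \<phi>] dg_le[of ?c \<phi>] by (intro mult_mono) auto
      also have "\<dots> = ?Q" using action_ck[OF J] by (simp add: power4_eq_xxxx power3_eq_cube)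
      finally show "1 - wp k (?c - f \<phi>) \<le> ?Q" .
    qed
    have "(wp k (?c - f \<phi>) - 1)\<^sup>2 / g ?c \<phi> \<le> ?Q\<^sup>2 * (wp k (?c - f \<phi>) ^ 0 / g ?c \<phi>)" for \<phi>
    proof -
      have "(wp k (?c - f \<phi>) - 1)\<^sup>2 \<le> ?Q\<^sup>2"
        using q[of \<phi>] power_mono[of "1 - wp k (?c - f \<phi>)" ?Q 2] by (simp add: power2_commute)
      then show ?thesis using g_pos[of ?c \<phi>] by (simp add: divide_right_mono)
    qed
    then have "integral {0..2 * pi} (\<lambda>\<phi>. (wp k (?c - f \<phi>) - 1)\<^sup>2 / g ?c \<phi>) \<le>
      integral {0..2 * pi} (\<lambda>\<phi>. ?Q\<^sup>2 * (wp k (?c - f \<phi>) ^ 0 / g ?c \<phi>))"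
      by (intro integral_le integrable_continuous_interval continuous_g_intros ballI g_nonzero)
    then have "mom f k 2 ?c - 2 * mom f k 1 ?c + mom f k 0 ?c \<le> ?Q\<^sup>2 * mom f k 0 ?c"
      unfolding integral_wp_quadratic integral_mult_right mom_def[symmetric] by simp
    then have "mom f k 2 ?c / mom f k 0 ?c - 2 * (mom f k 1 ?c / mom f k 0 ?c) + 1 \<le> ?Q\<^sup>2"
      using mom_0_pos[of ?c] by (simp add: field_simps)
    \<comment> \<open>This square is the amount by which the second moment about 1 exceeds the
      variance.\<close>
    moreover have "0 \<le> (mom f k 1 ?c / mom f k 0 ?c - 1)\<^sup>2" by simp
    ultimately have "var f k ?c \<le> ?Q\<^sup>2"
      unfolding var_eq by (simp add: power2_diff)
    then show "var f k ?c / ?d\<^sup>2 \<le> (M ^ 4 * J)\<^sup>2"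
      using daction_pos[of ?c] by (simp add: divide_le_eq power_mult_distrib)
  qed
qed

section \<open>The angle error as an integral over levels\<close>

abbreviation "dens J \<equiv> var f k (ck f k J) / (daction f k (ck f k J))\<^sup>2"

lemma dens_nonneg: "dens J \<ge> 0"
  by (simp add: var_nonneg)

lemma continuous_on_dens: "continuous_on {0<..} dens"
proof -
  have ck: "continuous_on {0<..} (ck f k)"
    using ck_has_derivative by (meson DERIV_continuous_on greaterThan_iff has_field_derivative_at_within)
  show ?thesis
    using daction_pos
    by (intro continuous_intros continuous_on_compose2[OF continuous_on_var ck]
        continuous_on_compose2[OF continuous_on_daction ck]) (auto simp: less_imp_neq[symmetric])
qed

text \<open>Continuity is available for positive actions only; near zero the quadratic bound
  dominates, and the single point 0 is negligible. A non-integrable function would have integral 0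
  by convention, and then no lower bound could be read off from a subinterval.\<close>

lemma dens_integrable: "dens integrable_on {0..R}"
proof -
  obtain M where M: "\<And>J. J > 0 \<Longrightarrow> dens J \<le> (M * J)\<^sup>2" using integrand_bound by blast
  have "dens integrable_on {0<..R}"
  proof (rule measurable_bounded_by_integrable_imp_integrable)
    show "dens \<in> borel_measurable (lebesgue_on {0<..R})"
      by (intro continuous_imp_measurable_on_sets_lebesgue continuous_on_subset[OF continuous_on_dens]) auto
    have "(\<lambda>J. (M * J)\<^sup>2) integrable_on {0..R}"
      by (intro integrable_continuous_interval continuous_intros)
    then show "(\<lambda>J. (M * J)\<^sup>2) integrable_on {0<..R}"
      by (rule integrable_spike_set) (auto intro: negligible_subset[of "{0}"])
    show "norm (dens J) \<le> (M * J)\<^sup>2" if "J \<in> {0<..R}" for J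
      using M[of J] that dens_nonneg[of J] by simp
  qed auto
  then show ?thesis
    by (rule integrable_spike_set) (auto intro: negligible_subset[of "{0}"])
qed

lemma E1_eq:
  assumes "R > 0"
  shows "E1 f R k t = 2 * integral {0..R} dens"
proof -
  let ?G = "\<lambda>J. dens \<bar>J\<bar>"
  have pos: "?G integrable_on {0..R}"
    by (rule integrable_eq[OF dens_integrable]) auto
  then have neg: "?G integrable_on {-R..0}"
    using Henstock_Kurzweil_Integration.integrable_reflect_real[where f = ?G and a = 0 and b = R] by simp
  have "?G integrable_on {-R..R}"
    by (rule Henstock_Kurzweil_Integration.integrable_combine[OF _ _ neg pos]) (use assms in simp_all)
  then have split: "integral {-R..0} ?G + integral {0..R} ?G = integral {-R..R} ?G"
    by (rule Henstock_Kurzweil_Integration.integral_combine[rotated 2]) (use assms in simp_all)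
  have "E1 f R k t = integral {-R..R} ?G"
    unfolding E1_def
    \<comment> \<open>The closed form holds for nonzero actions, so the point 0 is discarded as a
      null set.\<close>
    by (rule integral_spike[of "{0}"]) (use E1_inner_eq in auto)
  also note split[symmetric]
  also have "integral {-R..0} ?G = integral {0..R} ?G"
    using Henstock_Kurzweil_Integration.integral_reflect_real[where f = ?G and a = 0 and b = R] by simp
  also have "integral {0..R} ?G = integral {0..R} dens"
    by (rule integral_cong) auto
  finally show ?thesis by simp
qed

text \<open>Substituting \<open>J = action f k c\<close> cancels one of the two factors
  \<open>daction\<close>. The levels in \<open>{c\<^sub>1..c\<^sub>2}\<close> correspond to actions
  inside \<open>{0..R}\<close>, and the remaining actions contribute a nonnegative amount.\<close>

lemma E1_ge:
  assumes "c\<^sub>1 \<le> c\<^sub>2" "action f k c\<^sub>2 \<le> R"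
  shows "E1 f R k t \<ge> 2 * integral {c\<^sub>1..c\<^sub>2} (\<lambda>c. var f k c / daction f k c)"
proof -
  let ?a = "action f k c\<^sub>1" and ?b = "action f k c\<^sub>2"
  have mono: "action f k x \<le> action f k y" if "x \<le> y" for x y
    using action_strict_mono[of x y] that by (cases "x = y") auto
  have ab: "0 < ?a" "?a \<le> ?b" using action_pos mono[OF assms(1)] by auto
  have "((\<lambda>c. daction f k c *\<^sub>R dens (action f k c)) has_integral integral {?a..?b} dens) {c\<^sub>1..c\<^sub>2}"
  proof (rule has_integral_substitution[OF assms(1) ab(2)])
    show "action f k ` {c\<^sub>1..c\<^sub>2} \<subseteq> {?a..?b}" using mono by auto
    show "continuous_on {?a..?b} dens"
      by (rule continuous_on_subset[OF continuous_on_dens]) (use ab in auto)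
  qed (rule has_field_derivative_at_within[OF action_has_derivative])
  moreover have "daction f k c *\<^sub>R dens (action f k c) = var f k c / daction f k c" for c
    using daction_pos[of c] by (simp add: ck_action power2_eq_square)
  ultimately have "integral {c\<^sub>1..c\<^sub>2} (\<lambda>c. var f k c / daction f k c) = integral {?a..?b} dens"
    by (simp add: integral_unique)
  also have "\<dots> \<le> integral {0..R} dens"
    using ab assms(2) dens_nonneg
    by (intro integral_subset_le dens_integrable integrable_continuous_interval
        continuous_on_subset[OF continuous_on_dens]) auto
  finally show ?thesis using E1_eq[of R t] ab assms(2) by simp
qed

end

section \<open>The limit of large k\<close>

context circle_potential
begin

lemma f_min: obtains x\<^sub>0 where "\<And>x. f x\<^sub>0 \<le> f x" "x\<^sub>0 \<in> {0..2 * pi}"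
proof -
  obtain x\<^sub>0 where "\<And>x. f x\<^sub>0 \<le> f x"
    using periodic_attains_inf[of f, OF continuous_on_f f_periodic] by blast
  then show thesis
    using that[of "x\<^sub>0 rmod (2 * pi)"] rmod_circle_bounds periodic_rmod[of f, OF f_periodic] by simp
qed

lemma f_le_max: "f x \<le> max_circle f"
proof -
  obtain x\<^sub>1 where "\<And>x. f x \<le> f x\<^sub>1"
    using periodic_attains_sup[of f, OF continuous_on_f f_periodic] by blast
  then have "bdd_above (range f)" by (auto intro!: bdd_aboveI)
  then show ?thesis unfolding max_circle_def by (rule cSUP_upper2) auto
qed

text \<open>The parameter \<open>e = 1 / k\<close> turns the limits of all integrands into the continuity of a
  function \<open>H e g\<close> at \<open>e = 0\<close>.\<close>

lemma profile_integral_tendsto: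
  fixes H :: "real \<Rightarrow> real \<Rightarrow> real"
  assumes X: "X \<longlonglongrightarrow> c" and c: "c > max_circle f"
    and H: "continuous_on ({0..} \<times> {0<..}) (\<lambda>(e, g). H e g)"
    and w: "continuous_on UNIV w"
  shows "(\<lambda>k. integral {0..2 * pi} (\<lambda>\<phi>. w \<phi> * H (1 / real k) (prof k (X k - f \<phi>))))
    \<longlonglongrightarrow> integral {0..2 * pi} (\<lambda>\<phi>. w \<phi> * H 0 (sqrt (2 * (c - f \<phi>))))"
proof -
  obtain x\<^sub>0 where x0: "\<And>x. f x\<^sub>0 \<le> f x" using f_min by blast
  \<comment> \<open>Half the gap above the maximum: once \<open>X k\<close> exceeds
    \<open>c - r\<close>, the argument of the profile is at least \<open>r\<close> at every
    angle.\<close>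
  define r where "r = (c - max_circle f) / 2"
  have r: "r > 0" using c by (simp add: r_def)
  define a b where "a = min 1 (sqrt (2 * r))" and "b = max 1 (sqrt (2 * (c + r - f x\<^sub>0)))"
  have a: "a > 0" using r by (simp add: a_def)
  have "\<forall>\<^sub>F k in sequentially. c - r < X k \<and> X k < c + r"
    using order_tendstoD[OF X, of "c - r"] order_tendstoD(2)[OF X, of "c + r"] r
    by (auto simp: eventually_conj_iff)
  then obtain N where N: "\<And>k. k \<ge> N \<Longrightarrow> c - r < X k \<and> X k < c + r"
    unfolding eventually_sequentially by blast
  \<comment> \<open>Shifting the sequence by \<open>Suc N\<close> makes the bounds hold for every
    term and keeps all indices positive.\<close>
  define N' where "N' = Suc N"
  have bnd: "prof (k + N') (X (k + N') - f \<phi>) \<in> {a..b}" for k \<phi>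
  proof -
    have "c = max_circle f + 2 * r" by (simp add: r_def field_simps)
    then have "r \<le> X (k + N') - f \<phi>" "X (k + N') - f \<phi> \<le> c + r - f x\<^sub>0"
      using N[of "k + N'"] f_le_max[of \<phi>] x0[of \<phi>] by (auto simp: N'_def)
    then show ?thesis
      using prof_bounds[of "k + N'" r "X (k + N') - f \<phi>" "c + r - f x\<^sub>0"] r
      by (auto simp: a_def b_def N'_def)
  qed
  \<comment> \<open>For positive indices both \<open>1 / k\<close> and the profile stay in one
    compact rectangle inside the domain of \<open>H\<close>, which gives a bound uniform in
    \<open>k\<close>.\<close>
  have "compact ((\<lambda>(e, g). H e g) ` ({0..1} \<times> {a..b}))"
    by (intro compact_continuous_image compact_Times continuous_on_subset[OF H]) (use a in auto)
  then obtain B where B: "\<And>e g. e \<in> {0..1} \<Longrightarrow> g \<in> {a..b} \<Longrightarrow> \<bar>H e g\<bar> \<le> B"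
    by (fastforce dest!: compact_imp_bounded simp: bounded_iff)
  have "(\<lambda>k. integral {0..2 * pi} (\<lambda>\<phi>. w \<phi> * H (1 / real (k + N')) (prof (k + N') (X (k + N') - f \<phi>))))
    \<longlonglongrightarrow> integral {0..2 * pi} (\<lambda>\<phi>. w \<phi> * H 0 (sqrt (2 * (c - f \<phi>))))"
  proof (rule dominated_convergence(2)[where h = "\<lambda>\<phi>. \<bar>w \<phi>\<bar> * B"])
    show "(\<lambda>\<phi>. w \<phi> * H (1 / real (k + N')) (prof (k + N') (X (k + N') - f \<phi>))) integrable_on {0..2 * pi}" for k
    proof -
      have pos: "k + N' > 0" by (simp add: N'_def)
      have "continuous_on {0..2 * pi} (\<lambda>\<phi>. H (1 / real (k + N')) (prof (k + N') (X (k + N') - f \<phi>)))"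
      proof -
        have "continuous_on {0..2 * pi} (\<lambda>\<phi>. (1 / real (k + N'), prof (k + N') (X (k + N') - f \<phi>)))"
          by (intro continuous_on_Pair continuous_on_const continuous_on_compose_shift
              continuous_on_prof pos continuous_on_f)
        from continuous_on_compose2[OF H this] show ?thesis
          using prof_pos[OF pos] by (auto simp: image_subset_iff)
      qed
      then show ?thesis
        by (intro integrable_continuous_interval continuous_on_mult continuous_on_subset[OF w]) auto
    qed
    show "(\<lambda>\<phi>. \<bar>w \<phi>\<bar> * B) integrable_on {0..2 * pi}"
      by (intro integrable_continuous_interval continuous_intros continuous_on_subset[OF w]) auto
    show "norm (w \<phi> * H (1 / real (k + N')) (prof (k + N') (X (k + N') - f \<phi>))) \<le> \<bar>w \<phi>\<bar> * B" for k \<phi>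
      using B[OF _ bnd[of k \<phi>], of "1 / real (k + N')"]
      by (auto simp: abs_mult N'_def intro!: mult_left_mono)
    show "(\<lambda>k. w \<phi> * H (1 / real (k + N')) (prof (k + N') (X (k + N') - f \<phi>)))
      \<longlonglongrightarrow> w \<phi> * H 0 (sqrt (2 * (c - f \<phi>)))" for \<phi>
    proof -
      have cf: "c - f \<phi> > 0" using c f_le_max[of \<phi>] by simp
      have "(\<lambda>k. prof k (X k - f \<phi>)) \<longlonglongrightarrow> sqrt (2 * (c - f \<phi>))"
        by (intro prof_tendsto tendsto_diff X tendsto_const cf)
      then have 1: "(\<lambda>k. prof (k + N') (X (k + N') - f \<phi>)) \<longlonglongrightarrow> sqrt (2 * (c - f \<phi>))"
        by (rule LIMSEQ_ignore_initial_segment)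
      have 2: "(\<lambda>k. 1 / real (k + N')) \<longlonglongrightarrow> 0"
        by (rule LIMSEQ_ignore_initial_segment[OF lim_const_over_n])
      have "(\<lambda>k. (\<lambda>(e, g). H e g) (1 / real (k + N'), prof (k + N') (X (k + N') - f \<phi>)))
        \<longlonglongrightarrow> (\<lambda>(e, g). H e g) (0, sqrt (2 * (c - f \<phi>)))"
        using cf by (intro continuous_on_tendsto_compose[OF H] tendsto_Pair 1 2)
          (auto intro!: always_eventually prof_pos simp: N'_def)
      then show ?thesis by (intro tendsto_mult tendsto_const) simp
    qed
  qed
  then show ?thesis by (rule LIMSEQ_offset)
qed

section \<open>Limits of the moments and of the slope of the action\<close>

text \<open>At \<open>e = 1 / k\<close> the fraction \<open>1 / (g^2 + e)\<close> is
  \<open>k * wp\<close>, so this kernel is the integrand of the moment multiplied by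
  \<open>k ^ i\<close>.\<close>

lemma continuous_on_kernel:
  "continuous_on ({0..} \<times> {0<..}) (\<lambda>(e, g). (1 / (g\<^sup>2 + e)) ^ i / (g :: real))"
  unfolding split_beta
  by (intro continuous_intros) (auto, metis add_pos_nonneg less_irrefl zero_less_power)

lemma scaled_mom:
  assumes "k > 0"
  shows "real k ^ i * mom f k i c =
    integral {0..2 * pi} (\<lambda>\<phi>. 1 * ((1 / ((prof k (c - f \<phi>))\<^sup>2 + 1 / real k)) ^ i / prof k (c - f \<phi>)))"
proof -
  have "real k * wp k x = 1 / ((prof k x)\<^sup>2 + 1 / real k)" for x
    using assms prof_pos[OF assms, of x] by (simp add: wp_def field_simps)
  then show ?thesis
    unfolding mom_def by (subst integral_mult_right[symmetric]) (simp flip: power_mult_distrib)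
qed

text \<open>The right side is the kernel at \<open>e = 0\<close>, with the unit weight and the
  summand 0 kept so that it matches the limit of the integrals.\<close>

lemma a_int_eq:
  assumes c: "c > max_circle f"
  shows "a_int f (real i + 1 / 2) c =
    integral {0..2 * pi} (\<lambda>\<phi>. 1 * ((1 / ((sqrt (2 * (c - f \<phi>)))\<^sup>2 + 0)) ^ i / sqrt (2 * (c - f \<phi>))))"
  unfolding a_int_def
proof (rule integral_cong)
  fix \<phi> :: real
  have "2 * (c - f \<phi>) > 0" using c f_le_max[of \<phi>] by simp
  then show "1 / (2 * (c - f \<phi>)) powr (real i + 1 / 2) =
    1 * ((1 / ((sqrt (2 * (c - f \<phi>)))\<^sup>2 + 0)) ^ i / sqrt (2 * (c - f \<phi>)))"
    by (simp add: powr_add powr_realpow powr_half_sqrt power_divide)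
qed

lemma mom_tendsto:
  assumes "X \<longlonglongrightarrow> c" "c > max_circle f"
  shows "(\<lambda>k. real k ^ i * mom f k i (X k)) \<longlonglongrightarrow> a_int f (real i + 1 / 2) c"
proof -
  have "(\<lambda>k. integral {0..2 * pi} (\<lambda>\<phi>. 1 * ((1 / ((prof k (X k - f \<phi>))\<^sup>2 + 1 / real k)) ^ i / prof k (X k - f \<phi>))))
    \<longlonglongrightarrow> a_int f (real i + 1 / 2) c"
    unfolding a_int_eq[OF assms(2)]
    by (rule profile_integral_tendsto[OF assms continuous_on_kernel continuous_on_const])
  then show ?thesis
    by (rule Lim_transform_eventually)
       (use eventually_gt_at_top[of 0] in \<open>eventually_elim, simp add: scaled_mom\<close>)
qed

lemma mom_0_tendsto:
  assumes "X \<longlonglongrightarrow> c" "c > max_circle f"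
  shows "(\<lambda>k. mom f k 0 (X k)) \<longlonglongrightarrow> a_int f (1 / 2) c"
  using mom_tendsto[OF assms, of 0] by simp

lemma daction_tendsto:
  assumes "X \<longlonglongrightarrow> c" "c > max_circle f"
  shows "(\<lambda>k. daction f k (X k)) \<longlonglongrightarrow> a_int f (1 / 2) c / (2 * pi)"
proof -
  have cont: "continuous_on ({0..} \<times> {0<..}) (\<lambda>(e, g). g / (g\<^sup>2 + e :: real))"
    unfolding split_beta
    by (intro continuous_intros) (auto, metis add_pos_nonneg less_irrefl zero_less_power)
  have "(\<lambda>k. integral {0..2 * pi} (\<lambda>\<phi>. 1 * (prof k (X k - f \<phi>) / ((prof k (X k - f \<phi>))\<^sup>2 + 1 / real k))))
    \<longlonglongrightarrow> integral {0..2 * pi} (\<lambda>\<phi>. 1 * (sqrt (2 * (c - f \<phi>)) / ((sqrt (2 * (c - f \<phi>)))\<^sup>2 + 0)))"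
    by (rule profile_integral_tendsto[OF assms cont continuous_on_const])
  also have "integral {0..2 * pi} (\<lambda>\<phi>. 1 * (sqrt (2 * (c - f \<phi>)) / ((sqrt (2 * (c - f \<phi>)))\<^sup>2 + 0))) =
    a_int f (1 / 2) c"
  proof -
    \<comment> \<open>If the root vanishes, both sides are 0 by the convention on division by
      zero.\<close>
    have "sqrt (2 * (c - f \<phi>)) / ((sqrt (2 * (c - f \<phi>)))\<^sup>2 + 0) = 1 / sqrt (2 * (c - f \<phi>))" for \<phi>
      unfolding power2_eq_square add_0_right
      by (cases "sqrt (2 * (c - f \<phi>)) = 0") (simp_all del: real_sqrt_mult_self real_sqrt_abs2)
    then show ?thesis using a_int_eq[OF assms(2), of 0] by (simp only:) simp
  qed
  finally have "(\<lambda>k. 1 / (2 * pi) * integral {0..2 * pi} (\<lambda>\<phi>. 1 * (prof k (X k - f \<phi>) / ((prof k (X k - f \<phi>))\<^sup>2 + 1 / real k))))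
    \<longlonglongrightarrow> 1 / (2 * pi) * a_int f (1 / 2) c"
    by (rule tendsto_mult[OF tendsto_const])
  then have "(\<lambda>k. daction f k (X k)) \<longlonglongrightarrow> 1 / (2 * pi) * a_int f (1 / 2) c"
  proof (rule Lim_transform_eventually)
    have "dprof k x = prof k x / ((prof k x)\<^sup>2 + 1 / real k)" if "k > 0" for k x
      using that by (simp add: dprof_def field_simps)
    then show "\<forall>\<^sub>F k in sequentially. 1 / (2 * pi) * integral {0..2 * pi}
        (\<lambda>\<phi>. 1 * (prof k (X k - f \<phi>) / ((prof k (X k - f \<phi>))\<^sup>2 + 1 / real k))) = daction f k (X k)"
      by (auto intro!: eventually_mono[OF eventually_gt_at_top[of 0]] simp: daction_def)
  qed
  then show ?thesis by simp
qed

section \<open>The limiting action and convergence of the levels\<close>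

definition action0 :: "real \<Rightarrow> real" where
  "action0 c = 1 / (2 * pi) * integral {0..2 * pi} (gam0 f c)"

lemma action_tendsto:
  assumes c: "c > max_circle f"
  shows "(\<lambda>k. action f k c) \<longlonglongrightarrow> action0 c"
proof -
  have cont: "continuous_on ({0..} \<times> {0<..}) (\<lambda>(e :: real, g :: real). g)"
    unfolding split_beta by (intro continuous_intros)
  have "(\<lambda>k. integral {0..2 * pi} (\<lambda>\<phi>. 1 * prof k (c - f \<phi>)))
    \<longlonglongrightarrow> integral {0..2 * pi} (\<lambda>\<phi>. 1 * sqrt (2 * (c - f \<phi>)))"
    by (rule profile_integral_tendsto[OF tendsto_const c cont continuous_on_const])
  moreover have "gam0 f c = (\<lambda>\<phi>. sqrt (2 * (c - f \<phi>)))"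
  proof (intro ext)
    show "gam0 f c \<phi> = sqrt (2 * (c - f \<phi>))" for \<phi>
      using c f_le_max[of \<phi>] by (simp add: gam0_def)
  qed
  ultimately have "(\<lambda>k. integral {0..2 * pi} (\<lambda>\<phi>. prof k (c - f \<phi>))) \<longlonglongrightarrow> integral {0..2 * pi} (gam0 f c)"
    by simp
  then show ?thesis
    unfolding action_def action0_def by (rule tendsto_mult[OF tendsto_const])
qed

lemma gam0_max: "gam0 f c \<phi> = sqrt (2 * max 0 (c - f \<phi>))"
  by (simp add: gam0_def max_def)

lemma continuous_on_gam0: "continuous_on S (gam0 f c)"
  unfolding gam0_max[abs_def] by (intro continuous_intros continuous_on_f)

text \<open>At and below the minimum of \<open>f\<close> the limiting action is constantly 0, so
  positivity at the upper level is part of the statement. It puts that level above the minimum, and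
  at a minimiser of \<open>f\<close> the limiting profile grows strictly.\<close>

lemma action0_strict_mono:
  assumes "c < c'" "action0 c' > 0"
  shows "action0 c < action0 c'"
proof -
  obtain x\<^sub>0 where x0: "\<And>x. f x\<^sub>0 \<le> f x" "x\<^sub>0 \<in> {0..2 * pi}" using f_min by blast
  have "c' > f x\<^sub>0"
  proof (rule ccontr)
    assume "\<not> c' > f x\<^sub>0"
    then have "gam0 f c' = (\<lambda>_. 0)"
    proof (intro ext)
      show "gam0 f c' \<phi> = 0" for \<phi>
        using \<open>\<not> c' > f x\<^sub>0\<close> x0(1)[of \<phi>] by (simp add: gam0_def)
    qed
    then show False using assms(2) by (simp add: action0_def)
  qed
  have "integral {0..2 * pi} (\<lambda>\<phi>. gam0 f c' \<phi> - gam0 f c \<phi>) > 0"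
  proof (rule integral_pos_continuous[OF _ _ _ x0(2)])
    show "gam0 f c' x\<^sub>0 - gam0 f c x\<^sub>0 \<noteq> 0"
      using \<open>c' > f x\<^sub>0\<close> assms(1) by (auto simp: gam0_def)
    show "continuous_on {0..2 * pi} (\<lambda>\<phi>. gam0 f c' \<phi> - gam0 f c \<phi>)"
      by (intro continuous_on_diff continuous_on_gam0)
  qed (use assms(1) in \<open>auto simp: gam0_def\<close>)
  then have "integral {0..2 * pi} (gam0 f c) < integral {0..2 * pi} (gam0 f c')"
    by (subst (asm) integral_diff) (auto intro!: integrable_continuous_interval continuous_on_gam0)
  then show ?thesis by (simp add: action0_def divide_strict_right_mono)
qed

text \<open>The limiting action is 0 at the minimum of \<open>f\<close>. At the maximum plus
  \<open>J^2 / 2\<close> the profile is at least \<open>J\<close> everywhere; continuity gives a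
  level in between, and strict monotonicity at positive values makes it unique.\<close>

lemma action0_c0:
  assumes J: "J > 0"
  shows "action0 (c0 f J) = J"
proof -
  obtain x\<^sub>0 where x0: "\<And>x. f x\<^sub>0 \<le> f x" using f_min by blast
  obtain x\<^sub>1 where x1: "\<And>x. f x \<le> f x\<^sub>1"
    using periodic_attains_sup[of f, OF continuous_on_f f_periodic] by blast
  let ?c = "f x\<^sub>1 + J\<^sup>2 / 2"
  have "gam0 f (f x\<^sub>0) = (\<lambda>_. 0)" using x0 by (auto simp: gam0_def not_less[symmetric])
  then have "action0 (f x\<^sub>0) \<le> J" using J by (simp add: action0_def)
  moreover have "J \<le> action0 ?c"
  proof -
    have "J \<le> gam0 f ?c \<phi>" for \<phi>
    proof -
      have "J\<^sup>2 \<le> 2 * max 0 (?c - f \<phi>)"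
        using x1[of \<phi>] max.cobounded2[of "?c - f \<phi>" 0] by argo
      then show ?thesis unfolding gam0_max using J by (simp add: real_le_rsqrt)
    qed
    then have "integral {0..2 * pi} (\<lambda>_. J) \<le> integral {0..2 * pi} (gam0 f ?c)"
      by (intro integral_le integrable_continuous_interval continuous_on_gam0 continuous_on_const)
    then show ?thesis by (simp add: action0_def field_simps)
  qed
  moreover have "f x\<^sub>0 \<le> ?c" using x0[of x\<^sub>1] zero_le_power2[of J] by linarith
  moreover have "continuous_on {f x\<^sub>0..?c} action0"
  proof -
    have "continuous_on UNIV (\<lambda>x. sqrt (2 * max 0 x))" by (intro continuous_intros)
    from shifted_integral_continuous[OF this continuous_on_f continuous_on_const[of _ 1]]
    show ?thesis
      unfolding action0_def[abs_def] gam0_max[abs_def] by (intro continuous_intros) simp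
  qed
  ultimately obtain c where c: "action0 c = J"
    using IVT'[of action0 "f x\<^sub>0" J ?c] by blast
  have "c0 f J = c"
    unfolding c0_def action0_def[symmetric]
  proof (rule the_equality)
    show "J = action0 c" using c by simp
    show "c' = c" if "J = action0 c'" for c'
      using action0_strict_mono[of c c'] action0_strict_mono[of c' c] that c J
      by (cases c c' rule: linorder_cases) auto
  qed
  then show ?thesis using c by simp
qed

text \<open>Actions are compared at a fixed level on either side of \<open>c0 f J\<close>: there
  they converge to a value different from \<open>J\<close>, and monotonicity of
  \<open>action f k\<close> turns the inequality into one for \<open>ck f k J\<close>.\<close>

lemma ck_tendsto:
  assumes J: "J > 0" and c: "c0 f J > max_circle f"
  shows "(\<lambda>k. ck f k J) \<longlonglongrightarrow> c0 f J"
proof (rule order_tendstoI)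
  fix a
  assume "a < c0 f J"
  \<comment> \<open>The midpoint keeps the test level above the maximum of \<open>f\<close>, where
    the actions are known to converge.\<close>
  define b where "b = max a ((max_circle f + c0 f J) / 2)"
  have b: "a \<le> b" "b < c0 f J" "b > max_circle f"
    using \<open>a < c0 f J\<close> c by (auto simp: b_def less_max_iff_disj)
  have "action0 b < J" using action0_strict_mono[OF b(2)] action0_c0[OF J] J by simp
  then have "\<forall>\<^sub>F k in sequentially. action f k b < J"
    using order_tendstoD(2)[OF action_tendsto[OF b(3)]] by blast
  then show "\<forall>\<^sub>F k in sequentially. a < ck f k J"
    using eventually_gt_at_top[of 0]
  proof eventually_elim
    case (elim k)
    interpret circle_potential_k f k by unfold_locales (use elim in simp)
    have "b < ck f k J"
      using elim(1) action_ck[OF J] action_strict_mono[of "ck f k J" b]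
      by (metis linorder_neqE_linordered_idom order_less_asym less_irrefl)
    then show ?case using b(1) by simp
  qed
next
  fix b
  assume b: "c0 f J < b"
  have "action0 (c0 f J) < action0 b"
  proof (rule action0_strict_mono[OF b])
    have "c0 f J > f \<phi>" for \<phi> using c f_le_max[of \<phi>] by simp
    then have "gam0 f (c0 f J) \<phi> \<le> gam0 f b \<phi>" for \<phi> using b by (auto simp: gam0_max max_def)
    \<comment> \<open>The comparison without strictness comes first: it supplies the positivity that
      strict monotonicity asks for.\<close>
    then have "integral {0..2 * pi} (gam0 f (c0 f J)) \<le> integral {0..2 * pi} (gam0 f b)"
      by (intro integral_le integrable_continuous_interval continuous_on_gam0)
    then have "action0 (c0 f J) \<le> action0 b" by (simp add: action0_def divide_right_mono)
    then show "action0 b > 0" using action0_c0[OF J] J by simp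
  qed
  then have "\<forall>\<^sub>F k in sequentially. action f k b > J"
    using order_tendstoD(1)[OF action_tendsto[of b]] b c action0_c0[OF J] by simp
  then show "\<forall>\<^sub>F k in sequentially. ck f k J < b"
    using eventually_gt_at_top[of 0]
  proof eventually_elim
    case (elim k)
    interpret circle_potential_k f k by unfold_locales (use elim in simp)
    show ?case
      using elim(1) action_ck[OF J] action_strict_mono[of b "ck f k J"]
      by (metis linorder_neqE_linordered_idom order_less_asym less_irrefl)
  qed
qed

lemma a_int_half_pos:
  assumes c: "c > max_circle f"
  shows "a_int f (1 / 2) c > 0"
proof -
  have "continuous_on {0..2 * pi} (\<lambda>\<phi>. 1 / (2 * (c - f \<phi>)) powr \<delta>)" for \<delta>
    using c f_le_max by (intro continuous_intros continuous_on_f) (auto simp: not_less[symmetric])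
  then show ?thesis
    unfolding a_int_def using c f_le_max[of 0]
    by (intro integral_pos_continuous[where x\<^sub>0 = 0]) auto
qed

text \<open>In closed form \<open>k^2 * E2\<close> is the quotient of a kernel integral with
  exponent 2 and weight \<open>(deriv f)^2\<close> by \<open>mom f k 0\<close>, at the moving level
  \<open>ck f k J\<close>; numerator and denominator converge.\<close>

lemma E2_tendsto:
  assumes J: "J > 0" and c: "c0 f J > max_circle f"
  shows "(\<lambda>k. (real k)\<^sup>2 * E2 f J k t) \<longlonglongrightarrow> 1 / a_int f (1 / 2) (c0 f J) *
    integral {0..2 * pi} (\<lambda>\<phi>. \<bar>deriv f \<phi>\<bar>\<^sup>2 / (2 * (c0 f J - f \<phi>)) powr (5 / 2))"
proof -
  let ?c = "c0 f J"
  have cont: "continuous_on UNIV (\<lambda>\<phi>. (deriv f \<phi>)\<^sup>2)"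
    by (intro continuous_intros continuous_on_deriv_f)
  have "(\<lambda>k. integral {0..2 * pi} (\<lambda>\<phi>. (deriv f \<phi>)\<^sup>2 *
      ((1 / ((prof k (ck f k J - f \<phi>))\<^sup>2 + 1 / real k)) ^ 2 / prof k (ck f k J - f \<phi>))))
    \<longlonglongrightarrow> integral {0..2 * pi} (\<lambda>\<phi>. (deriv f \<phi>)\<^sup>2 *
      ((1 / ((sqrt (2 * (?c - f \<phi>)))\<^sup>2 + 0)) ^ 2 / sqrt (2 * (?c - f \<phi>))))"
    by (rule profile_integral_tendsto[OF ck_tendsto[OF J c] c continuous_on_kernel cont])
  also have "integral {0..2 * pi} (\<lambda>\<phi>. (deriv f \<phi>)\<^sup>2 *
      ((1 / ((sqrt (2 * (?c - f \<phi>)))\<^sup>2 + 0)) ^ 2 / sqrt (2 * (?c - f \<phi>)))) =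
    integral {0..2 * pi} (\<lambda>\<phi>. \<bar>deriv f \<phi>\<bar>\<^sup>2 / (2 * (?c - f \<phi>)) powr (5 / 2))"
  proof (rule integral_cong)
    fix \<phi> :: real
    have pos: "2 * (?c - f \<phi>) > 0" using c f_le_max[of \<phi>] by simp
    have "(2 * (?c - f \<phi>)) powr (real 2 + 1 / 2) = (2 * (?c - f \<phi>)) ^ 2 * sqrt (2 * (?c - f \<phi>))"
      using pos by (subst powr_add, subst powr_realpow) (simp_all add: powr_half_sqrt)
    then have "(2 * (?c - f \<phi>)) powr (5 / 2) = (2 * (?c - f \<phi>)) ^ 2 * sqrt (2 * (?c - f \<phi>))"
      by simp
    then show "(deriv f \<phi>)\<^sup>2 * ((1 / ((sqrt (2 * (?c - f \<phi>)))\<^sup>2 + 0)) ^ 2 / sqrt (2 * (?c - f \<phi>))) =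
      \<bar>deriv f \<phi>\<bar>\<^sup>2 / (2 * (?c - f \<phi>)) powr (5 / 2)"
      using pos by (simp add: power_divide)
  qed
  finally have "(\<lambda>k. integral {0..2 * pi} (\<lambda>\<phi>. (deriv f \<phi>)\<^sup>2 *
      ((1 / ((prof k (ck f k J - f \<phi>))\<^sup>2 + 1 / real k)) ^ 2 / prof k (ck f k J - f \<phi>))) / mom f k 0 (ck f k J))
    \<longlonglongrightarrow> integral {0..2 * pi} (\<lambda>\<phi>. \<bar>deriv f \<phi>\<bar>\<^sup>2 / (2 * (?c - f \<phi>)) powr (5 / 2)) / a_int f (1 / 2) ?c"
    using a_int_half_pos[OF c]
    by (intro tendsto_divide mom_0_tendsto ck_tendsto J c) auto
  then have "(\<lambda>k. (real k)\<^sup>2 * E2 f J k t) \<longlonglongrightarrow>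
     integral {0..2 * pi} (\<lambda>\<phi>. \<bar>deriv f \<phi>\<bar>\<^sup>2 / (2 * (?c - f \<phi>)) powr (5 / 2)) / a_int f (1 / 2) ?c"
  proof (rule Lim_transform_eventually)
    show "\<forall>\<^sub>F k in sequentially. integral {0..2 * pi} (\<lambda>\<phi>. (deriv f \<phi>)\<^sup>2 *
      ((1 / ((prof k (ck f k J - f \<phi>))\<^sup>2 + 1 / real k)) ^ 2 / prof k (ck f k J - f \<phi>))) / mom f k 0 (ck f k J) =
      (real k)\<^sup>2 * E2 f J k t"
      using eventually_gt_at_top[of 0]
    proof eventually_elim
      case (elim k)
      interpret circle_potential_k f k by unfold_locales (rule elim)
      have "1 / ((prof k x)\<^sup>2 + 1 / real k) = real k * wp k x" for x
        using k prof_pos[OF k, of x] by (simp add: wp_def field_simps)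
      then have "integral {0..2 * pi} (\<lambda>\<phi>. (deriv f \<phi>)\<^sup>2 *
          ((1 / ((prof k (ck f k J - f \<phi>))\<^sup>2 + 1 / real k)) ^ 2 / prof k (ck f k J - f \<phi>))) =
        integral {0..2 * pi} (\<lambda>\<phi>. (real k)\<^sup>2 * ((deriv f \<phi> * wp k (ck f k J - f \<phi>))\<^sup>2 * (1 / g (ck f k J) \<phi>)))"
        by (simp add: power_mult_distrib mult_ac)
      then show ?case
        unfolding E2_eq[OF J] by (simp only: integral_mult_right) simp
    qed
  qed
  then show ?thesis by (simp add: mult.commute)
qed

end

section \<open>The limit density and the lower bound for the angle error\<close>

lemma constant_on_UNIV_periodic:
  fixes p :: "real \<Rightarrow> 'a"
  assumes per: "\<And>x. p (x + 2 * pi) = p x" and "\<And>x. x \<in> {0..2 * pi} \<Longrightarrow> p x = y"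
  shows "p x = y"
  using periodic_rmod[of p x, OF per] assms(2)[of "x rmod (2 * pi)"] rmod_circle_bounds[of x] by simp

context circle_potential
begin

text \<open>The variance of \<open>1 / (2 * (c - f))\<close> under the density proportional to
  \<open>1 / sqrt (2 * (c - f))\<close>, divided once more by
  \<open>a_int f (1 / 2) c\<close>.\<close>

definition limit_dens :: "real \<Rightarrow> real" where
  "limit_dens c = (- (a_int f (3 / 2) c)\<^sup>2 + a_int f (5 / 2) c * a_int f (1 / 2) c) / (a_int f (1 / 2) c) ^ 3"

lemma continuous_on_a_int: "continuous_on {max_circle f<..} (a_int f \<delta>)"
proof -
  have "2 * (c - f \<phi>) \<noteq> 0" if "c > max_circle f" for c \<phi>
    using that f_le_max[of \<phi>] by simp
  then have "continuous_on ({max_circle f<..} \<times> cbox 0 (2 * pi)) (\<lambda>(c, \<phi>). 1 / (2 * (c - f \<phi>)) powr \<delta>)"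
    unfolding split_beta
    by (intro continuous_intros continuous_on_compose2[OF continuous_on_f[of UNIV]]) auto
  from integral_continuous_on_param[OF this] show ?thesis
    by (simp add: a_int_def[abs_def])
qed

lemma continuous_on_limit_dens: "continuous_on {max_circle f<..} limit_dens"
  unfolding limit_dens_def[abs_def] using a_int_half_pos
  by (intro continuous_intros continuous_on_a_int) (auto simp: less_imp_neq[symmetric])

lemma a_int_cases:
  assumes c: "c > max_circle f"
  shows "a_int f (1 / 2) c = integral {0..2 * pi} (\<lambda>\<phi>. 1 / sqrt (2 * (c - f \<phi>)))"
    and "a_int f (3 / 2) c = integral {0..2 * pi} (\<lambda>\<phi>. 1 / (2 * (c - f \<phi>)) / sqrt (2 * (c - f \<phi>)))"
    and "a_int f (5 / 2) c = integral {0..2 * pi} (\<lambda>\<phi>. (1 / (2 * (c - f \<phi>)))\<^sup>2 / sqrt (2 * (c - f \<phi>)))"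
proof -
  have "2 * (c - f \<phi>) \<ge> 0" for \<phi> using c f_le_max[of \<phi>] by simp
  then have eq: "a_int f (real i + 1 / 2) c =
      integral {0..2 * pi} (\<lambda>\<phi>. (1 / (2 * (c - f \<phi>))) ^ i / sqrt (2 * (c - f \<phi>)))" for i
    unfolding a_int_eq[OF c] by (simp only: real_sqrt_pow2 mult_1 add_0_right)
  show "a_int f (1 / 2) c = integral {0..2 * pi} (\<lambda>\<phi>. 1 / sqrt (2 * (c - f \<phi>)))"
    "a_int f (3 / 2) c = integral {0..2 * pi} (\<lambda>\<phi>. 1 / (2 * (c - f \<phi>)) / sqrt (2 * (c - f \<phi>)))"
    "a_int f (5 / 2) c = integral {0..2 * pi} (\<lambda>\<phi>. (1 / (2 * (c - f \<phi>)))\<^sup>2 / sqrt (2 * (c - f \<phi>)))"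
    using eq[of 0] eq[of 1] eq[of 2] by simp_all
qed

text \<open>A variance vanishes only for a constant function, and \<open>1 / (2 * (c - f))\<close>
  is constant only if \<open>f\<close> is. The number \<open>m\<close> in the proof is the
  mean.\<close>

lemma limit_dens_pos:
  assumes nonconst: "\<not> f constant_on UNIV" and c: "c > max_circle f"
  shows "limit_dens c > 0"
proof -
  have pos: "2 * (c - f \<phi>) > 0" for \<phi> using c f_le_max[of \<phi>] by simp
  have nz1: "2 * (c - f \<phi>) \<noteq> 0" for \<phi> by (rule less_imp_neq[OF pos, symmetric])
  have nz2: "sqrt (2 * (c - f \<phi>)) \<noteq> 0" for \<phi> unfolding real_sqrt_eq_zero_cancel_iff by (rule nz1)
  note nz = nz1 nz2
  define m where "m = a_int f (3 / 2) c / a_int f (1 / 2) c"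
  let ?p = "\<lambda>\<phi>. 1 / (2 * (c - f \<phi>))" and ?s = "\<lambda>\<phi>. sqrt (2 * (c - f \<phi>))"
  note intros = continuous_intros continuous_on_f nz ballI
  have "\<exists>x\<^sub>0\<in>{0..2 * pi}. ?p x\<^sub>0 \<noteq> m"
  proof (rule ccontr)
    assume "\<not> ?thesis"
    then have "?p x = m" if "x \<in> {0..2 * pi}" for x using that by blast
    then have "?p x = m" for x
      using constant_on_UNIV_periodic[of ?p m x] by (simp add: f_periodic)
    then have eq: "1 / ?p x = 1 / ?p 0" for x by metis
    have "f x = f 0" for x using eq[of x] by simp
    then show False using nonconst by (auto simp: constant_on_def)
  qed
  then obtain x\<^sub>0 where x0: "x\<^sub>0 \<in> {0..2 * pi}" "?p x\<^sub>0 \<noteq> m" by blast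
  have "0 < integral {0..2 * pi} (\<lambda>\<phi>. (?p \<phi> - m)\<^sup>2 / ?s \<phi>)"
  proof (rule integral_pos_continuous[OF _ _ _ x0(1)])
    show "continuous_on {0..2 * pi} (\<lambda>\<phi>. (?p \<phi> - m)\<^sup>2 / ?s \<phi>)" by (intro intros)
    show "(?p x\<^sub>0 - m)\<^sup>2 / ?s x\<^sub>0 \<noteq> 0" using x0(2) nz(2)[of x\<^sub>0] by simp
    show "0 \<le> (?p \<phi> - m)\<^sup>2 / ?s \<phi>" for \<phi> using pos[of \<phi>] by simp
  qed simp
  also have "integral {0..2 * pi} (\<lambda>\<phi>. (?p \<phi> - m)\<^sup>2 / ?s \<phi>) =
    integral {0..2 * pi} (\<lambda>\<phi>. (?p \<phi>)\<^sup>2 / ?s \<phi> - (2 * m) * (?p \<phi> / ?s \<phi>) + m\<^sup>2 * (1 / ?s \<phi>))"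
    by (intro integral_cong) (simp only: power2_diff diff_divide_distrib add_divide_distrib, simp)
  also have "\<dots> = a_int f (5 / 2) c - (2 * m) * a_int f (3 / 2) c + m\<^sup>2 * a_int f (1 / 2) c"
  proof -
    have "(\<lambda>\<phi>. (?p \<phi>)\<^sup>2 / ?s \<phi>) integrable_on {0..2 * pi}" "(\<lambda>\<phi>. ?p \<phi> / ?s \<phi>) integrable_on {0..2 * pi}"
      "(\<lambda>\<phi>. 1 / ?s \<phi>) integrable_on {0..2 * pi}"
      by (intro integrable_continuous_interval intros)+
    then show ?thesis
      unfolding a_int_cases[OF c]
      by (simp only: integral_add integral_diff integrable_diff integrable_on_mult_right integral_mult_right)
  qed
  finally have "0 < a_int f (5 / 2) c - (2 * m) * a_int f (3 / 2) c + m\<^sup>2 * a_int f (1 / 2) c" .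
  then have "0 < - (a_int f (3 / 2) c)\<^sup>2 + a_int f (5 / 2) c * a_int f (1 / 2) c"
    using a_int_half_pos[OF c] by (simp add: m_def field_simps power2_eq_square)
  then show ?thesis using a_int_half_pos[OF c] by (simp add: limit_dens_def)
qed

text \<open>One factor \<open>k\<close> goes to each power of \<open>wp\<close> in the variance. The
  factor \<open>2 * pi\<close> appears because \<open>daction\<close> is a mean and
  \<open>a_int\<close> an integral.\<close>

lemma scaled_dens_tendsto:
  assumes c: "c > max_circle f"
  shows "(\<lambda>k. (real k)\<^sup>2 * (var f k c / daction f k c)) \<longlonglongrightarrow> 2 * pi * limit_dens c"
proof -
  let ?V = "\<lambda>k. (real k ^ 2 * mom f k 2 c / mom f k 0 c - (real k ^ 1 * mom f k 1 c / mom f k 0 c)\<^sup>2) / daction f k c"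
  have nz: "a_int f (1 / 2) c \<noteq> 0" using a_int_half_pos[OF c] by simp
  have "?V \<longlonglongrightarrow> (a_int f (real 2 + 1 / 2) c / a_int f (1 / 2) c -
      (a_int f (real 1 + 1 / 2) c / a_int f (1 / 2) c)\<^sup>2) / (a_int f (1 / 2) c / (2 * pi))"
    by (intro tendsto_intros mom_tendsto mom_0_tendsto daction_tendsto c) (use nz in auto)
  also have "(a_int f (real 2 + 1 / 2) c / a_int f (1 / 2) c -
      (a_int f (real 1 + 1 / 2) c / a_int f (1 / 2) c)\<^sup>2) / (a_int f (1 / 2) c / (2 * pi)) =
    2 * pi * limit_dens c"
    using nz by (simp add: limit_dens_def field_simps power2_eq_square power3_eq_cube)
  finally show ?thesis
  proof (rule Lim_transform_eventually)
    show "\<forall>\<^sub>F k in sequentially. ?V k = (real k)\<^sup>2 * (var f k c / daction f k c)"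
      using eventually_gt_at_top[of 0]
    proof eventually_elim
      case (elim k)
      interpret circle_potential_k f k by unfold_locales (rule elim)
      show ?case by (simp add: var_eq power_divide power_mult_distrib right_diff_distrib)
    qed
  qed
qed

text \<open>Supplies the majorant for dominated convergence in the level. With the profile in
  \<open>{a..b}\<close> one has \<open>k * wp \<le> 1 / a^2\<close> and, since
  \<open>1 / k \<le> 1\<close>, also \<open>dg \<ge> a / (b^2 + 1)\<close>; the variance is at most
  the second moment.\<close>

lemma scaled_dens_bounded:
  assumes c1: "c\<^sub>1 > max_circle f"
  obtains B where "\<And>k c. k > 0 \<Longrightarrow> c \<in> {c\<^sub>1..c\<^sub>2} \<Longrightarrow> (real k)\<^sup>2 * (var f k c / daction f k c) \<le> B"
proof -
  obtain x\<^sub>0 where x0: "\<And>x. f x\<^sub>0 \<le> f x" using f_min by blast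
  define r where "r = c\<^sub>1 - max_circle f"
  have r: "r > 0" using c1 by (simp add: r_def)
  define a b where "a = min 1 (sqrt (2 * r))" and "b = max 1 (sqrt (2 * (c\<^sub>2 - f x\<^sub>0)))"
  have a: "a > 0" using r by (simp add: a_def)
  show thesis
  proof (rule that[of "(1 / a ^ 4) / (a / (b\<^sup>2 + 1))"])
    fix k :: nat and c
    assume "k > 0" and c: "c \<in> {c\<^sub>1..c\<^sub>2}"
    then interpret circle_potential_k f k by unfold_locales simp
    have g: "a \<le> g c \<phi>" "g c \<phi> \<le> b" for \<phi>
    proof -
      have "r \<le> c - f \<phi>" "c - f \<phi> \<le> c\<^sub>2 - f x\<^sub>0" using c f_le_max[of \<phi>] x0[of \<phi>] by (auto simp: r_def)
      then show "a \<le> g c \<phi>" "g c \<phi> \<le> b"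
        using prof_bounds[OF k r, of "c - f \<phi>" "c\<^sub>2 - f x\<^sub>0"] by (auto simp: a_def b_def)
    qed
    have kw: "(real k * wp k (c - f \<phi>))\<^sup>2 \<le> 1 / a ^ 4" for \<phi>
    proof -
      have "real k * wp k (c - f \<phi>) = 1 / ((g c \<phi>)\<^sup>2 + 1 / real k)"
        using k by (simp add: wp_def field_simps)
      also have "\<dots> \<le> 1 / a\<^sup>2"
        using a g(1)[of \<phi>] power_mono[of a "g c \<phi>" 2] k by (intro divide_left_mono) (auto intro!: add_increasing2 mult_pos_pos add_pos_pos)
      finally have "(real k * wp k (c - f \<phi>))\<^sup>2 \<le> (1 / a\<^sup>2)\<^sup>2"
        by (intro power_mono) (simp_all add: wp_def)
      then show ?thesis by (simp add: power_divide)
    qed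
    have "(real k)\<^sup>2 * (wp k (c - f \<phi>) ^ 2 / g c \<phi>) \<le> 1 / a ^ 4 * (wp k (c - f \<phi>) ^ 0 / g c \<phi>)" for \<phi>
      using divide_right_mono[OF kw less_imp_le[OF g_pos], of \<phi> c \<phi>] by (simp add: power_mult_distrib)
    then have "integral {0..2 * pi} (\<lambda>\<phi>. (real k)\<^sup>2 * (wp k (c - f \<phi>) ^ 2 / g c \<phi>)) \<le>
      integral {0..2 * pi} (\<lambda>\<phi>. 1 / a ^ 4 * (wp k (c - f \<phi>) ^ 0 / g c \<phi>))"
      by (intro integral_le integrable_continuous_interval continuous_g_intros ballI g_nonzero)
    then have "(real k)\<^sup>2 * mom f k 2 c \<le> 1 / a ^ 4 * mom f k 0 c"
      unfolding integral_mult_right mom_def[symmetric] .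
    then have "(real k)\<^sup>2 * (mom f k 2 c / mom f k 0 c) \<le> 1 / a ^ 4"
      using mom_0_pos[of c] by (simp add: field_simps)
    moreover have "var f k c \<le> mom f k 2 c / mom f k 0 c" by (simp add: var_eq)
    then have "(real k)\<^sup>2 * var f k c \<le> (real k)\<^sup>2 * (mom f k 2 c / mom f k 0 c)"
      by (rule mult_left_mono) simp
    ultimately have v: "(real k)\<^sup>2 * var f k c \<le> 1 / a ^ 4" by simp
    have "a / (b\<^sup>2 + 1) \<le> dg c \<phi>" for \<phi>
    proof -
      have "dg c \<phi> = g c \<phi> / ((g c \<phi>)\<^sup>2 + 1 / real k)"
        using k by (simp add: dprof_def field_simps)
      moreover have "(g c \<phi>)\<^sup>2 + 1 / real k \<le> b\<^sup>2 + 1"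
        using g[of \<phi>] a k by (intro add_mono power_mono) auto
      ultimately show ?thesis
        using g[of \<phi>] a k by (simp add: frac_le add_nonneg_pos)
    qed
    then have "integral {0..2 * pi} (\<lambda>_. a / (b\<^sup>2 + 1)) \<le> integral {0..2 * pi} (dg c)"
      by (intro integral_le integrable_continuous_interval continuous_on_dg continuous_on_const)
    then have "a / (b\<^sup>2 + 1) \<le> daction f k c" by (simp add: daction_def field_simps)
    moreover have "0 < a / (b\<^sup>2 + 1)" using a by (simp add: add_nonneg_pos)
    ultimately have "((real k)\<^sup>2 * var f k c) / daction f k c \<le> (1 / a ^ 4) / (a / (b\<^sup>2 + 1))"
      using v a by (intro frac_le) auto
    then show "(real k)\<^sup>2 * (var f k c / daction f k c) \<le> (1 / a ^ 4) / (a / (b\<^sup>2 + 1))" by simp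
  qed
qed

lemma integral_scaled_dens_tendsto:
  assumes c1: "c\<^sub>1 > max_circle f"
  shows "(\<lambda>k. (real k)\<^sup>2 * integral {c\<^sub>1..c\<^sub>2} (\<lambda>c. var f k c / daction f k c))
    \<longlonglongrightarrow> 2 * pi * integral {c\<^sub>1..c\<^sub>2} limit_dens"
proof -
  obtain B where B: "\<And>k c. k > 0 \<Longrightarrow> c \<in> {c\<^sub>1..c\<^sub>2} \<Longrightarrow> (real k)\<^sup>2 * (var f k c / daction f k c) \<le> B"
    using scaled_dens_bounded[OF c1] by blast
  \<comment> \<open>The sequence is indexed by \<open>Suc n\<close> because continuity and the
    majorant hold for positive \<open>k\<close>.\<close>
  have "(\<lambda>n. integral {c\<^sub>1..c\<^sub>2} (\<lambda>c. (real (Suc n))\<^sup>2 * (var f (Suc n) c / daction f (Suc n) c)))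
    \<longlonglongrightarrow> integral {c\<^sub>1..c\<^sub>2} (\<lambda>c. 2 * pi * limit_dens c)"
  proof (rule dominated_convergence(2)[where h = "\<lambda>_. B"])
    fix n
    interpret circle_potential_k f "Suc n" by unfold_locales simp
    show "(\<lambda>c. (real (Suc n))\<^sup>2 * (var f (Suc n) c / daction f (Suc n) c)) integrable_on {c\<^sub>1..c\<^sub>2}"
      using daction_pos
      by (intro integrable_continuous_interval continuous_intros continuous_on_var continuous_on_daction)
        (metis less_irrefl)
    show "norm ((real (Suc n))\<^sup>2 * (var f (Suc n) c / daction f (Suc n) c)) \<le> B" if "c \<in> {c\<^sub>1..c\<^sub>2}" for c
      using B[OF _ that, of "Suc n"] var_nonneg[of c] daction_pos[of c] by simp
  next
    show "(\<lambda>n. (real (Suc n))\<^sup>2 * (var f (Suc n) c / daction f (Suc n) c)) \<longlonglongrightarrow> 2 * pi * limit_dens c"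
      if "c \<in> {c\<^sub>1..c\<^sub>2}" for c
      using LIMSEQ_Suc[OF scaled_dens_tendsto[of c]] that c1 by simp
  qed auto
  then show ?thesis
    unfolding integral_mult_right by (rule LIMSEQ_imp_Suc)
qed

text \<open>A strictly larger limit is obtained by starting the integral below
  \<open>max_circle f + r\<close>. This surplus pays both for ending it before \<open>c0 f R\<close>
  and for the error at finite \<open>k\<close>.\<close>

lemma E1_lower_bound:
  assumes nonconst: "\<not> f constant_on UNIV"
    and r: "r > 0" and R: "R > 0" and c: "c0 f R > max_circle f + r"
  shows "0 < 4 * pi * integral {max_circle f + r..c0 f R} limit_dens"
    and "\<forall>\<^sub>F k in sequentially. \<forall>t. 4 * pi * integral {max_circle f + r..c0 f R} limit_dens / (real k)\<^sup>2 \<le> E1 f R k t"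
proof -
  define c\<^sub>1 where "c\<^sub>1 = max_circle f + r / 2"
  have c1: "c\<^sub>1 > max_circle f" "c\<^sub>1 < max_circle f + r" using r by (simp_all add: c\<^sub>1_def)
  have cont: "continuous_on {a..b} limit_dens" if "a > max_circle f" for a b
    by (rule continuous_on_subset[OF continuous_on_limit_dens]) (use that in auto)
  have pos: "integral {a..b} limit_dens > 0" if "a > max_circle f" "a < b" for a b
    by (rule integral_pos_continuous[where x\<^sub>0 = a])
      (use that limit_dens_pos[OF nonconst] cont in \<open>force intro: less_imp_le\<close>)+
  show "0 < 4 * pi * integral {max_circle f + r..c0 f R} limit_dens"
    using pos[of "max_circle f + r" "c0 f R"] r c by simp
  have "integral {c\<^sub>1..max_circle f + r} limit_dens + integral {max_circle f + r..c0 f R} limit_dens =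
      integral {c\<^sub>1..c0 f R} limit_dens"
    using c1 c by (intro Henstock_Kurzweil_Integration.integral_combine integrable_continuous_interval cont) auto
  then have less: "integral {max_circle f + r..c0 f R} limit_dens < integral {c\<^sub>1..c0 f R} limit_dens"
    using pos[OF c1] by linarith
  \<comment> \<open>At \<open>c0 f R\<close> itself the action \<open>action f k\<close> might
    exceed \<open>R\<close>. By continuity of the integral in its upper end, a slightly smaller
    level retains part of the surplus while its limiting action lies strictly below
    \<open>R\<close>.\<close>
  obtain c\<^sub>2 where c2: "c\<^sub>1 < c\<^sub>2" "c\<^sub>2 < c0 f R"
    "integral {max_circle f + r..c0 f R} limit_dens < integral {c\<^sub>1..c\<^sub>2} limit_dens"
  proof -
    let ?F = "\<lambda>x. integral {c\<^sub>1..x} limit_dens"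
    have "continuous_on {c\<^sub>1..c0 f R} ?F"
      by (intro indefinite_integral_continuous_1 integrable_continuous_interval cont c1)
    then have "(?F \<longlongrightarrow> ?F (c0 f R)) (at (c0 f R) within {c\<^sub>1..c0 f R})"
      using c c1 by (simp add: continuous_on_def)
    then have "(?F \<longlongrightarrow> ?F (c0 f R)) (at_left (c0 f R))"
      using c c1 by (simp add: at_within_Icc_at_left)
    then have "\<forall>\<^sub>F x in at_left (c0 f R). integral {max_circle f + r..c0 f R} limit_dens < ?F x"
      using less by (rule order_tendstoD(1))
    moreover have "\<forall>\<^sub>F x in at_left (c0 f R). x \<in> {c\<^sub>1<..<c0 f R}"
      using c c1 by (intro eventually_at_left_real) auto
    ultimately have "\<forall>\<^sub>F x in at_left (c0 f R). c\<^sub>1 < x \<and> x < c0 f R \<and>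
        integral {max_circle f + r..c0 f R} limit_dens < ?F x"
      by eventually_elim auto
    then show thesis
      using eventually_happens[of _ "at_left (c0 f R)"] that by auto
  qed
  have "action0 c\<^sub>2 < R"
    using action0_strict_mono[OF c2(2)] action0_c0[OF R] R by simp
  then have ev1: "\<forall>\<^sub>F k in sequentially. action f k c\<^sub>2 < R"
    using order_tendstoD(2)[OF action_tendsto[of c\<^sub>2]] c1 c2 by simp
  have "2 * pi * integral {max_circle f + r..c0 f R} limit_dens < 2 * pi * integral {c\<^sub>1..c\<^sub>2} limit_dens"
    using c2(3) by simp
  then have ev2: "\<forall>\<^sub>F k in sequentially. 2 * pi * integral {max_circle f + r..c0 f R} limit_dens <
      (real k)\<^sup>2 * integral {c\<^sub>1..c\<^sub>2} (\<lambda>c. var f k c / daction f k c)"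
    by (rule order_tendstoD(1)[OF integral_scaled_dens_tendsto[OF c1(1)]])
  show "\<forall>\<^sub>F k in sequentially. \<forall>t. 4 * pi * integral {max_circle f + r..c0 f R} limit_dens / (real k)\<^sup>2 \<le> E1 f R k t"
    using ev1 ev2 eventually_gt_at_top[of 0]
  proof eventually_elim
    case (elim k)
    interpret circle_potential_k f k by unfold_locales (rule elim(3))
    show ?case
    proof
      fix t
      \<comment> \<open>The factor 4 combines the two signs of the action with the
        \<open>2 * pi\<close> of the limit.\<close>
      have "4 * pi * integral {max_circle f + r..c0 f R} limit_dens \<le>
         (real k)\<^sup>2 * (2 * integral {c\<^sub>1..c\<^sub>2} (\<lambda>c. var f k c / daction f k c))"
        using elim(2) by simp
      also have "\<dots> \<le> (real k)\<^sup>2 * E1 f R k t"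
        using E1_ge[of c\<^sub>1 c\<^sub>2 R t] c2 elim(1) by (intro mult_left_mono) auto
      finally show "4 * pi * integral {max_circle f + r..c0 f R} limit_dens / (real k)\<^sup>2 \<le> E1 f R k t"
        using k by (simp add: divide_le_eq mult.commute)
    qed
  qed
qed

text \<open>A nonconstant \<open>f\<close> has a nonzero derivative somewhere on
  \<open>{0..2 * pi}\<close>, which makes the continuous nonnegative integrand positive
  there.\<close>

lemma E2_limit_pos:
  assumes nonconst: "\<not> f constant_on UNIV" and c: "c > max_circle f"
  shows "1 / a_int f (1 / 2) c *
    integral {0..2 * pi} (\<lambda>\<phi>. \<bar>deriv f \<phi>\<bar>\<^sup>2 / (2 * (c - f \<phi>)) powr (5 / 2)) > 0"
proof -
  have nz: "c - f \<phi> > 0" for \<phi> using c f_le_max[of \<phi>] by simp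
  have "\<exists>x\<^sub>0\<in>{0..2 * pi}. deriv f x\<^sub>0 \<noteq> 0"
  proof (rule ccontr)
    assume "\<not> ?thesis"
    then have "deriv f x = 0" for x
      using constant_on_UNIV_periodic[of "deriv f" 0 x] deriv_f_periodic by blast
    then have "\<forall>x. (f has_real_derivative 0) (at x)" using f_has_derivative by metis
    then have "f x = f 0" for x by (rule DERIV_isconst_all)
    then show False using nonconst by (auto simp: constant_on_def)
  qed
  then obtain x\<^sub>0 where x0: "x\<^sub>0 \<in> {0..2 * pi}" "deriv f x\<^sub>0 \<noteq> 0" by blast
  have "integral {0..2 * pi} (\<lambda>\<phi>. \<bar>deriv f \<phi>\<bar>\<^sup>2 / (2 * (c - f \<phi>)) powr (5 / 2)) > 0"
  proof (rule integral_pos_continuous[OF _ _ _ x0(1)])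
    show "continuous_on {0..2 * pi} (\<lambda>\<phi>. \<bar>deriv f \<phi>\<bar>\<^sup>2 / (2 * (c - f \<phi>)) powr (5 / 2))"
      using nz by (intro continuous_intros continuous_on_deriv_f continuous_on_f) (auto simp: less_imp_neq[symmetric])
    show "\<bar>deriv f x\<^sub>0\<bar>\<^sup>2 / (2 * (c - f x\<^sub>0)) powr (5 / 2) \<noteq> 0" using x0(2) nz[of x\<^sub>0] by simp
  qed auto
  then show ?thesis using a_int_half_pos[OF c] by simp
qed

end

theorem theorem4p1:
  fixes f :: "real \<Rightarrow> real"
  assumes C2: "C2_circle f"
    and nonconst: "\<not> f constant_on UNIV"
  shows
    "(\<forall>r>0. \<forall>R>0. c0 f R > max_circle f + r \<longrightarrow>
       (\<exists>K>0. \<exists>c_R>0.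
          c_R = 4 * pi * integral {max_circle f + r..c0 f R}
                  (\<lambda>c. (- (a_int f (3/2) c)\<^sup>2 + a_int f (5/2) c * a_int f (1/2) c) / (a_int f (1/2) c) ^ 3) \<and>
          (\<forall>k::nat. real k > K \<longrightarrow> (\<forall>t. E1 f R k t \<ge> c_R / (real k)\<^sup>2))))
     \<and>
     (\<forall>J>0. c0 f J > max_circle f \<longrightarrow>
       (\<exists>c_J>0.
          c_J = 1 / a_int f (1/2) (c0 f J) *
                  integral {0..2*pi}
                    (\<lambda>\<phi>. \<bar>deriv f \<phi>\<bar>\<^sup>2 / (2 * (c0 f J - f \<phi>)) powr (5/2)) \<and>
          (\<forall>t. (\<lambda>k::nat. (real k)\<^sup>2 * E2 f J k t) \<longlonglongrightarrow> c_J)))"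
proof -
  interpret circle_potential f by unfold_locales (rule C2)
  show ?thesis
  proof (intro conjI allI impI)
    fix r R :: real
    assume *: "r > 0" "R > 0" "c0 f R > max_circle f + r"
    let ?c = "4 * pi * integral {max_circle f + r..c0 f R} limit_dens"
    obtain N where N: "\<And>k t. k \<ge> N \<Longrightarrow> ?c / (real k)\<^sup>2 \<le> E1 f R k t"
      using E1_lower_bound(2)[OF nonconst *] unfolding eventually_sequentially by blast
    show "\<exists>K>0. \<exists>c_R>0.
          c_R = 4 * pi * integral {max_circle f + r..c0 f R}
                  (\<lambda>c. (- (a_int f (3/2) c)\<^sup>2 + a_int f (5/2) c * a_int f (1/2) c) / (a_int f (1/2) c) ^ 3) \<and>
          (\<forall>k::nat. real k > K \<longrightarrow> (\<forall>t. E1 f R k t \<ge> c_R / (real k)\<^sup>2))"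
    \<comment> \<open>The successor makes the threshold \<open>K\<close> positive even if
      \<open>N\<close> is 0.\<close>
    proof (rule exI[of _ "real (Suc N)"], intro conjI exI[of _ ?c] allI impI)
      show "?c / (real k)\<^sup>2 \<le> E1 f R k t" if "real (Suc N) < real k" for k t
        using that by (intro N) simp
    qed (use E1_lower_bound(1)[OF nonconst *] in \<open>simp_all add: limit_dens_def[abs_def]\<close>)
  next
    fix J :: real
    assume *: "J > 0" "c0 f J > max_circle f"
    show "\<exists>c_J>0.
          c_J = 1 / a_int f (1/2) (c0 f J) *
                  integral {0..2*pi}
                    (\<lambda>\<phi>. \<bar>deriv f \<phi>\<bar>\<^sup>2 / (2 * (c0 f J - f \<phi>)) powr (5/2)) \<and>
          (\<forall>t. (\<lambda>k::nat. (real k)\<^sup>2 * E2 f J k t) \<longlonglongrightarrow> c_J)"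
      using E2_limit_pos[OF nonconst *(2)] E2_tendsto[OF *] by blast
  qed
qed

end
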